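(* Let $w\in S_n$ be an inverse fireworks permutation. Then $$\widehat{\mathfrak{G}}_w(\mathbf{x})=\sum_{B\in \mathsf{BVPD}(w)}\mathsf{wt}_B(\mathbf{x}).$$
   Context: Fix an integer $n\ge 1$. Cells of a grid are written $(i,j)$: row $i$ counted from the top, column $j$ counted from the left, both starting at $1$. Tiles. A cell is filled with one of: the blank tile; the H-tile (one strand joining the left and right edges); the J-tile (one strand joining the left and top edges); the R-tile (one strand joining the bottom and right edges); the bump tile (two strands, one joining left and top, the other joining bottom and right); the cross tile (strands meeting all four edges). Neighbouring tiles must match along shared edges, and in every tiling below pipes enter through the left boundary of the grid and exit through the top boundary (no strand meets the right or bottom boundary). Tracing pipes. The pipe entering from row $p$ is called pipe $p$. Pipes are traced from the left boundary to the top boundary, processing rows from bottom to top and cells in a row from left to right. At a cross tile where pipe $p$ enters from the left and pipe $q$ from the bottom: if $p$ and $q$ have not crossed before, they cross in this tile, $p$ exits right and $q$ exits top; otherwise they do not cross here, $p$ exits top and $q$ exits right. (Equivalently, pipe $\max(p,q)$ exits top.) Pipe dreams. A pipe dream (PD) is such a tiling of the $n\times n$ grid by cross, bump, J- and blank tiles with a pipe entering from every row and exiting from every column (so the J-tiles are exactly at $i+j=n+1$, blanks at $i+j>n+1$, and cross or bump tiles at $i+j\le n$). For $w\in S_n$, $\mathsf{PD}(w)$ is the set of PDs such that for each $c$ the pipe exiting at the top of column $c$ is pipe $w^{-1}(c)$. For a PD $P$, $\mathsf{wty}(P)$ is the set of cells that are cross tiles and $\mathsf{wt}_P(\mathbf{x})=\prod_{(i,j)\in\mathsf{wty}(P)}x_i$.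 The polynomial $\widehat{\mathfrak{G}}_w(\mathbf{x})$ (Castelnuovo–Mumford polynomial) is $\sum_P \mathsf{wt}_P(\mathbf{x})$ over all $P\in\mathsf{PD}(w)$ for which $|\mathsf{wty}(P)|$ is maximal among elements of $\mathsf{PD}(w)$; up to sign it is the top-degree homogeneous component of the Grothendieck polynomial $\mathfrak{G}_w(\mathbf{x})=\sum_{P\in\mathsf{PD}(w)}(-1)^{|\mathsf{wty}(P)|-\ell(w)}\mathsf{wt}_P(\mathbf{x})$, where $\ell(w)$ is the number of inversions. Inverse fireworks. Split the one-line notation of a permutation into its maximal consecutive decreasing runs. The permutation is fireworks if the first numbers of the runs are increasing from left to right; $w$ is inverse fireworks if $w^{-1}$ is fireworks. BVPDs. A bumpless vertical-less pipe dream (BVPD) is such a tiling of the grid with $n$ rows and $n-1$ columns by blank, H-, cross, J- and R-tiles. Its column-to-row code is the sequence of $n-1$ numbers whose $c$-th entry is $r$ if pipe $r$ exits at the top of column $c$, and $0$ if no pipe exits at column $c$. For inverse fireworks $w$, $\alpha(w)$ is obtained from $(w^{-1}(1),\dots,w^{-1}(n))$ by replacing the first number of each decreasing run by $0$ and then deleting the first entry. $\mathsf{BVPD}(w)$ is the set of BVPDs with column-to-row code $\alpha(w)$. For a BVPD $B$, $\mathsf{wty}(B)$ is the set of cells that are cross, J- or H-tiles, and $\mathsf{wt}_B(\mathbf{x})=\prod_{(i,j)\in\mathsf{wty}(B)}x_i$. *)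

theory Defs
  imports "HOL-Library.Poly_Mapping" "HOL-Combinatorics.Permutations"
begin

datatype tile = BlankT | HT | JT | RT | BumpT | CrossT

datatype edge = LeftE | TopE | RightE | BottomE

fun edges :: "tile \<Rightarrow> edge set" where
  "edges BlankT = {}"
| "edges HT = {LeftE, RightE}"
| "edges JT = {LeftE, TopE}"
| "edges RT = {BottomE, RightE}"
| "edges BumpT = {LeftE, TopE, BottomE, RightE}"
| "edges CrossT = {LeftE, TopE, BottomE, RightE}"

text \<open>
  \<open>tiling n m T\<close>: \<open>T\<close> is a tiling of the grid with \<open>n\<close> rows and \<open>m\<close> columns; \<open>T i j\<close> is the tile in
  row \<open>i\<close> (from the top) and column \<open>j\<close> (from the left), both starting at 1. Outside the grid \<open>T\<close>
  takes the dummy value \<open>BlankT\<close>, so that tilings correspond to unique functions.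
\<close>

definition tiling :: "nat \<Rightarrow> nat \<Rightarrow> (nat \<Rightarrow> nat \<Rightarrow> tile) \<Rightarrow> bool" where
  "tiling n m T \<longleftrightarrow>
     (\<forall>i j. \<not> (i \<in> {1..n} \<and> j \<in> {1..m}) \<longrightarrow> T i j = BlankT) \<and>
     (\<forall>i\<in>{1..n}. \<forall>j\<in>{1..<m}. RightE \<in> edges (T i j) \<longleftrightarrow> LeftE \<in> edges (T i (j + 1))) \<and>
     (\<forall>i\<in>{1..<n}. \<forall>j\<in>{1..m}. BottomE \<in> edges (T i j) \<longleftrightarrow> TopE \<in> edges (T (i + 1) j)) \<and>
     (\<forall>i\<in>{1..n}. RightE \<notin> edges (T i m)) \<and>
     (\<forall>j\<in>{1..m}. BottomE \<notin> edges (T n j))"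

definition cells_with :: "nat \<Rightarrow> nat \<Rightarrow> tile set \<Rightarrow> (nat \<Rightarrow> nat \<Rightarrow> tile) \<Rightarrow> (nat \<times> nat) set" where
  "cells_with n m S T = {(i, j). i \<in> {1..n} \<and> j \<in> {1..m} \<and> T i j \<in> S}"

text \<open>
  Edges of cells are labelled by the pipe running through them, and by \<open>0\<close> if there is none.
  \<open>trace_tile t p q C = (a, b, C')\<close>: label \<open>p\<close> arrives from the left and \<open>q\<close> from the bottom, label
  \<open>a\<close> leaves at the top and \<open>b\<close> at the right. \<open>C\<close> and \<open>C'\<close> are the sets of those pairs \<open>{p, q}\<close> of pipes
  that have already crossed before, respectively after, visiting this tile.
\<close>

fun trace_tile :: "tile \<Rightarrow> nat \<Rightarrow> nat \<Rightarrow> nat set set \<Rightarrow> nat \<times> nat \<times> nat set set" where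
  "trace_tile BlankT p q C = (0, 0, C)"
| "trace_tile HT p q C = (0, p, C)"
| "trace_tile JT p q C = (p, 0, C)"
| "trace_tile RT p q C = (0, q, C)"
| "trace_tile BumpT p q C = (p, q, C)"
| "trace_tile CrossT p q C = (if {p, q} \<notin> C then (q, p, insert {p, q} C) else (p, q, C))"

text \<open>
  The state within a row is \<open>(h, v, C)\<close>: \<open>h\<close> is the label on the left edge of the current cell and
  \<open>v j\<close> is the label on the highest horizontal edge already reached in column \<open>j\<close>.
\<close>

fun trace_cell :: "(nat \<Rightarrow> nat \<Rightarrow> tile) \<Rightarrow> nat \<Rightarrow> nat \<Rightarrow>
    nat \<times> (nat \<Rightarrow> nat) \<times> nat set set \<Rightarrow> nat \<times> (nat \<Rightarrow> nat) \<times> nat set set" where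
  "trace_cell T i j (h, v, C) =
     (case trace_tile (T i j) h (v j) C of (a, b, C') \<Rightarrow> (b, v(j := a), C'))"

fun trace_row :: "nat \<Rightarrow> (nat \<Rightarrow> nat \<Rightarrow> tile) \<Rightarrow> nat \<Rightarrow>
    (nat \<Rightarrow> nat) \<times> nat set set \<Rightarrow> (nat \<Rightarrow> nat) \<times> nat set set" where
  "trace_row m T i (v, C) =
     snd (fold (trace_cell T i) [1..<m + 1] (if LeftE \<in> edges (T i 1) then i else 0, v, C))"

text \<open>\<open>exit_pipe n m T c\<close> is the pipe exiting at the top of column \<open>c\<close>, and \<open>0\<close> if there is none.\<close>

definition exit_pipe :: "nat \<Rightarrow> nat \<Rightarrow> (nat \<Rightarrow> nat \<Rightarrow> tile) \<Rightarrow> nat \<Rightarrow> nat" where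
  "exit_pipe n m T = fst (fold (trace_row m T) (rev [1..<n + 1]) (\<lambda>_. 0, {}))"

text \<open>Integer polynomials in variables indexed by \<open>nat\<close>; the keys are exponent vectors.\<close>

type_synonym ipoly = "(nat \<Rightarrow>\<^sub>0 nat) \<Rightarrow>\<^sub>0 int"

definition X :: "nat \<Rightarrow> ipoly" where
  "X i = Poly_Mapping.single (Poly_Mapping.single i 1) 1"

definition weight :: "(nat \<times> nat) set \<Rightarrow> ipoly" where
  "weight D = (\<Prod>(i, j)\<in>D. X i)"

definition pipe_dream :: "nat \<Rightarrow> (nat \<Rightarrow> nat \<Rightarrow> tile) \<Rightarrow> bool" where
  "pipe_dream n P \<longleftrightarrow>
     tiling n n P \<and>
     (\<forall>i\<in>{1..n}. \<forall>j\<in>{1..n}. P i j \<in> {CrossT, BumpT, JT, BlankT}) \<and>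
     (\<forall>i\<in>{1..n}. LeftE \<in> edges (P i 1)) \<and>
     (\<forall>j\<in>{1..n}. TopE \<in> edges (P 1 j))"

definition PD :: "nat \<Rightarrow> (nat \<Rightarrow> nat) \<Rightarrow> (nat \<Rightarrow> nat \<Rightarrow> tile) set" where
  "PD n w = {P. pipe_dream n P \<and> (\<forall>c\<in>{1..n}. exit_pipe n n P c = inv w c)}"

definition wty_PD :: "nat \<Rightarrow> (nat \<Rightarrow> nat \<Rightarrow> tile) \<Rightarrow> (nat \<times> nat) set" where
  "wty_PD n P = cells_with n n {CrossT} P"

text \<open>The Castelnuovo--Mumford polynomial: the sum runs over the pipe dreams of \<open>w\<close> with maximally many crosses.\<close>

definition CM_poly :: "nat \<Rightarrow> (nat \<Rightarrow> nat) \<Rightarrow> ipoly" where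
  "CM_poly n w =
     (\<Sum>P | P \<in> PD n w \<and> (\<forall>Q\<in>PD n w. card (wty_PD n Q) \<le> card (wty_PD n P)).
        weight (wty_PD n P))"

definition one_line :: "nat \<Rightarrow> (nat \<Rightarrow> nat) \<Rightarrow> nat list" where
  "one_line n w = map w [1..<n + 1]"

text \<open>The decomposition of a list into its maximal consecutive decreasing runs.\<close>

fun dec_runs :: "nat list \<Rightarrow> nat list list" where
  "dec_runs [] = []"
| "dec_runs [x] = [[x]]"
| "dec_runs (x # y # zs) =
     (let rs = dec_runs (y # zs) in if x > y then (x # hd rs) # tl rs else [x] # rs)"

definition fireworks :: "nat \<Rightarrow> (nat \<Rightarrow> nat) \<Rightarrow> bool" where
  "fireworks n w \<longleftrightarrow> sorted_wrt (<) (map hd (dec_runs (one_line n w)))"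

definition inverse_fireworks :: "nat \<Rightarrow> (nat \<Rightarrow> nat) \<Rightarrow> bool" where
  "inverse_fireworks n w \<longleftrightarrow> fireworks n (inv w)"

text \<open>Bumpless vertical-less pipe dreams.\<close>

definition bvpd :: "nat \<Rightarrow> (nat \<Rightarrow> nat \<Rightarrow> tile) \<Rightarrow> bool" where
  "bvpd n B \<longleftrightarrow>
     tiling n (n - 1) B \<and>
     (\<forall>i\<in>{1..n}. \<forall>j\<in>{1..n - 1}. B i j \<in> {BlankT, HT, CrossT, JT, RT})"

definition column_to_row_code :: "nat \<Rightarrow> (nat \<Rightarrow> nat \<Rightarrow> tile) \<Rightarrow> nat list" where
  "column_to_row_code n B = map (exit_pipe n (n - 1) B) [1..<n]"

definition alpha_code :: "nat \<Rightarrow> (nat \<Rightarrow> nat) \<Rightarrow> nat list" where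
  "alpha_code n w = tl (concat (map (\<lambda>r. 0 # tl r) (dec_runs (one_line n (inv w)))))"

definition BVPD :: "nat \<Rightarrow> (nat \<Rightarrow> nat) \<Rightarrow> (nat \<Rightarrow> nat \<Rightarrow> tile) set" where
  "BVPD n w = {B. bvpd n B \<and> column_to_row_code n B = alpha_code n w}"

definition wty_BVPD :: "nat \<Rightarrow> (nat \<Rightarrow> nat \<Rightarrow> tile) \<Rightarrow> (nat \<times> nat) set" where
  "wty_BVPD n B = cells_with n (n - 1) {CrossT, JT, HT} B"

end

theory Submission
  imports Defs
begin

text \<open>
  Let \<open>v\<close> be the one-line notation of the inverse of \<open>w\<close>, that is, the sequence of exiting pipes, and call
  a value of \<open>v\<close> a record if it is larger than everything to its left.

  Follow the labels along the lattice path between the traced and the untraced cells, the front. A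
  bump does not change this sequence, and a cross sorts two neighbouring labels into decreasing order
  (\<open>exit_pipe_front\<close>). Decreasing pairs therefore persist until the end, and so a record never has a
  larger label before it (\<open>no_larger_before_record\<close>). Consequently a record pipe on the way to column
  \<open>p\<close> enters every cell from the left only to turn up, and must leave every column before \<open>p\<close> through
  a bump that it enters from below. The number of bumps with a record below is thus fixed by \<open>w\<close>, and
  the number of crosses is a constant minus the number of bad bumps, those with a nonrecord
  below (\<open>card_crosses\<close>). If \<open>v\<close> is fireworks, there is a pipe dream without bad bumps
  (\<open>no_bad_bumps_greedy_crosses\<close>), so the pipe dreams that contribute to the Castelnuovo--Mumford
  polynomial are exactly those without bad bumps.

  In such a pipe dream a cell is a cross exactly if the pipe leaving it on the right exists and is not
  a record (\<open>cross_iff_right_not_record\<close>). Erase all record pipes and delete the first column. What is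
  left is a bumpless vertical-less pipe dream; its code is \<open>v\<close> with the records replaced by \<open>0\<close> and
  the first entry deleted, which is \<open>alpha_code\<close> because the records of a fireworks sequence are the
  heads of its decreasing runs. The right edges of the cells \<open>(i, j)\<close> of the pipe dream have become the
  left edges of the cells \<open>(i, j)\<close> of the new tiling, so the two weights are products over the same set of
  cells (\<open>wty_shadow\<close>).

  Conversely, the cells with a left edge in a bumpless vertical-less pipe dream serve as the crosses of a
  pipe dream. By induction along the tracing order, the erased labels are the left-to-right maxima
  of each front, which forces the exit sequence to be \<open>v\<close> and excludes bad bumps
  (\<open>realizes_wty_bvpd\<close>, \<open>bad_bumps_wty_bvpd\<close>). Tilings of either kind are determined by these sets of
  cells (\<open>pd_of_wty\<close>, \<open>bvpd_eqI\<close>), so both sides of the identity are sums over the same family of sets.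
\<close>

section \<open>Fronts\<close>

text \<open>
  The effect of a tile on the two neighbouring labels at positions \<open>k\<close> and \<open>Suc k\<close> of a front: before
  the tile they are the left and the bottom label, after it the top and the right label. The rule
  for crosses replaces the bookkeeping of crossed pairs by a comparison: the larger pipe leaves at
  the top. An H-tile has bottom label \<open>0\<close>, so moving the pipe to the right edge is also a swap. The other
  tiles move nothing, since their missing edges carry label \<open>0\<close>.
\<close>

definition cell_op :: "tile \<Rightarrow> nat \<Rightarrow> (nat \<Rightarrow> nat) \<Rightarrow> nat \<Rightarrow> nat" where
  "cell_op t k F =
     (if t = HT \<or> t = CrossT \<and> F k < F (Suc k) then F(k := F (Suc k), Suc k := F k) else F)"

definition entry :: "(nat \<Rightarrow> nat \<Rightarrow> tile) \<Rightarrow> nat \<Rightarrow> nat" where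
  "entry T i = (if LeftE \<in> edges (T i 1) then i else 0)"

text \<open>
  \<open>front n m T d k\<close> lists the labels along the lattice path that separates the traced cells from the
  others when row \<open>n - d\<close> has been traced up to column \<open>k\<close>. Positions below \<open>k\<close> are the tops of the
  columns \<open>1..k\<close> in that row, position \<open>k\<close> is the vertical edge to the right of column \<open>k\<close>, and a position
  \<open>a > k\<close> is the bottom edge of column \<open>a\<close> in that row. Starting a row puts the entering pipe in front of the list.
\<close>

fun front :: "nat \<Rightarrow> nat \<Rightarrow> (nat \<Rightarrow> nat \<Rightarrow> tile) \<Rightarrow> nat \<Rightarrow> nat \<Rightarrow> nat \<Rightarrow> nat" where
  "front n m T 0 0 = case_nat (entry T n) (\<lambda>_. 0)"
| "front n m T (Suc d) 0 = case_nat (entry T (n - Suc d)) (front n m T d m)"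
| "front n m T d (Suc k) = cell_op (T (n - d) (Suc k)) k (front n m T d k)"

section \<open>Tracing pipes by fronts\<close>

text \<open>
  The intermediate states of the folds in the definition of \<open>exit_pipe\<close>, indexed like \<open>front\<close>, so
  that both recursions can be compared cell by cell.
\<close>

fun trace_state ::
  "nat \<Rightarrow> nat \<Rightarrow> (nat \<Rightarrow> nat \<Rightarrow> tile) \<Rightarrow> nat \<Rightarrow> nat \<Rightarrow> nat \<times> (nat \<Rightarrow> nat) \<times> nat set set" where
  "trace_state n m T 0 0 = (entry T n, \<lambda>_. 0, {})"
| "trace_state n m T (Suc d) 0 = (entry T (n - Suc d), snd (trace_state n m T d m))"
| "trace_state n m T d (Suc k) = trace_cell T (n - d) (Suc k) (trace_state n m T d k)"

lemma trace_state_row: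
  "trace_state n m T d k = fold (trace_cell T (n - d)) [1..<Suc k] (trace_state n m T d 0)"
  by (induction k) simp_all

lemma trace_state_rows:
  assumes "d < n"
  shows "fold (trace_row m T) (rev [n - d..<Suc n]) (\<lambda>_. 0, {}) = snd (trace_state n m T d m)"
  using assms
proof (induction d)
  case 0
  then show ?case
    using trace_state_row[of n m T 0 m] by (simp add: entry_def)
next
  case (Suc d)
  have "[n - Suc d..<Suc n] = (n - Suc d) # [n - d..<Suc n]"
    using Suc.prems by (simp add: upt_conv_Cons Suc_diff_Suc)
  moreover have "trace_row m T (n - Suc d) s =
      snd (fold (trace_cell T (n - Suc d)) [1..<Suc m] (entry T (n - Suc d), s))" for s
    by (cases s) (simp add: entry_def)
  ultimately show ?case
    using Suc trace_state_row[of n m T "Suc d" m] by simp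
qed

lemma exit_pipe_trace_state:
  assumes "n \<ge> 1"
  shows "exit_pipe n m T c = fst (snd (trace_state n m T (n - 1) m)) c"
  using trace_state_rows[of "n - 1" n m T] assms by (simp add: exit_pipe_def)

lemma tilingD:
  assumes "tiling n m T"
  shows "\<not> (i \<in> {1..n} \<and> j \<in> {1..m}) \<Longrightarrow> T i j = BlankT"
    and "1 \<le> i \<Longrightarrow> i \<le> n \<Longrightarrow> 1 \<le> j \<Longrightarrow> j < m \<Longrightarrow>
      RightE \<in> edges (T i j) \<longleftrightarrow> LeftE \<in> edges (T i (Suc j))"
    and "1 \<le> i \<Longrightarrow> i < n \<Longrightarrow> 1 \<le> j \<Longrightarrow> j \<le> m \<Longrightarrow>
      BottomE \<in> edges (T i j) \<longleftrightarrow> TopE \<in> edges (T (Suc i) j)"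
    and "1 \<le> i \<Longrightarrow> i \<le> n \<Longrightarrow> RightE \<notin> edges (T i m)"
    and "1 \<le> j \<Longrightarrow> j \<le> m \<Longrightarrow> BottomE \<notin> edges (T n j)"
  using assms unfolding tiling_def by (auto simp: Ball_def)

text \<open>
  Labels and strands agree: an edge of the path carries a nonzero label exactly when the tiles have
  a strand through it. This is what makes \<open>0\<close> a faithful code for an absent pipe.
\<close>

lemma front_edges:
  assumes T: "tiling n m T" and "d < n" "k \<le> m"
  shows "(front n m T d k k \<noteq> 0 \<longleftrightarrow> k < m \<and> LeftE \<in> edges (T (n - d) (Suc k))) \<and>
    (\<forall>a<k. front n m T d k a \<noteq> 0 \<longleftrightarrow> TopE \<in> edges (T (n - d) (Suc a))) \<and>
    (\<forall>a>k. front n m T d k a \<noteq> 0 \<longleftrightarrow> a \<le> m \<and> BottomE \<in> edges (T (n - d) a))"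
  using assms
proof (induction n m T d k rule: front.induct[case_names first row cell])
  case (first n m T)
  have "m = 0 \<Longrightarrow> T n (Suc 0) = BlankT"
    using first tilingD(1) by simp
  then show ?case
    using first tilingD(5)[OF first(1)] by (cases "m = 0") (auto simp: entry_def split: nat.split)
next
  case (row n m T d)
  have IH: "front n m T d m a \<noteq> 0 \<longleftrightarrow> a < m \<and> TopE \<in> edges (T (n - d) (Suc a))" for a
    using row.IH row.prems by (cases a m rule: linorder_cases) auto
  have m0: "m = 0 \<Longrightarrow> T (n - Suc d) (Suc 0) = BlankT"
    using row tilingD(1) by simp
  have v: "BottomE \<in> edges (T (n - Suc d) j) \<longleftrightarrow> TopE \<in> edges (T (n - d) j)" if "1 \<le> j" "j \<le> m" for j
    using tilingD(3)[OF row.prems(1), of "n - Suc d" j] that row.prems by (simp add: Suc_diff_Suc)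
  have "front n m T (Suc d) 0 a \<noteq> 0 \<longleftrightarrow> a \<le> m \<and> BottomE \<in> edges (T (n - Suc d) a)" if "0 < a" for a
  proof (cases a)
    case (Suc b)
    then show ?thesis using IH[of b] v[of a] by auto
  qed (use that in simp)
  moreover have "front n m T (Suc d) 0 0 \<noteq> 0 \<longleftrightarrow> 0 < m \<and> LeftE \<in> edges (T (n - Suc d) (Suc 0))"
    using m0 row.prems by (cases "m = 0") (auto simp: entry_def)
  ultimately show ?case by simp
next
  case (cell n m T d k)
  let ?F = "front n m T d k" and ?t = "T (n - d) (Suc k)"
  have k: "?F k \<noteq> 0 \<longleftrightarrow> LeftE \<in> edges ?t" "?F (Suc k) \<noteq> 0 \<longleftrightarrow> BottomE \<in> edges ?t"
    and lt: "\<And>a. a < k \<Longrightarrow> ?F a \<noteq> 0 \<longleftrightarrow> TopE \<in> edges (T (n - d) (Suc a))"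
    and gt: "\<And>a. a > k \<Longrightarrow> ?F a \<noteq> 0 \<longleftrightarrow> a \<le> m \<and> BottomE \<in> edges (T (n - d) a)"
    using cell by auto
  have top: "cell_op ?t k ?F k \<noteq> 0 \<longleftrightarrow> TopE \<in> edges ?t"
    and right: "cell_op ?t k ?F (Suc k) \<noteq> 0 \<longleftrightarrow> RightE \<in> edges ?t"
    using k by (cases ?t; auto simp: cell_op_def)+
  have r: "RightE \<in> edges ?t \<longleftrightarrow> Suc k < m \<and> LeftE \<in> edges (T (n - d) (Suc (Suc k)))"
  proof (cases "Suc k < m")
    case True
    then show ?thesis using tilingD(2)[OF cell.prems(1), of "n - d" "Suc k"] cell.prems by simp
  next
    case False
    then have "Suc k = m" using cell.prems by simp
    then show ?thesis using tilingD(4)[OF cell.prems(1), of "n - d"] cell.prems by simp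
  qed
  have other: "cell_op ?t k ?F a = ?F a" if "a \<noteq> k" "a \<noteq> Suc k" for a
    using that by (simp add: cell_op_def)
  have "cell_op ?t k ?F a \<noteq> 0 \<longleftrightarrow> TopE \<in> edges (T (n - d) (Suc a))" if "a < Suc k" for a
    using that top other[of a] lt[of a] by (cases "a = k") auto
  moreover have "cell_op ?t k ?F a \<noteq> 0 \<longleftrightarrow> a \<le> m \<and> BottomE \<in> edges (T (n - d) a)" if "a > Suc k" for a
    using that other[of a] gt[of a] by auto
  ultimately show ?case using right r by simp
qed

text \<open>
  Two pipes on the front have crossed exactly if they appear in decreasing order. The lower bound
  \<open>i\<close> on all labels makes the pipe that enters in the next row up smaller than, and uncrossed with, all
  others.
\<close>

definition crossing_record :: "nat \<Rightarrow> (nat \<Rightarrow> nat) \<Rightarrow> nat set set \<Rightarrow> bool" where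
  "crossing_record i F C \<longleftrightarrow>
     (\<forall>a b. a < b \<longrightarrow> F a \<noteq> 0 \<longrightarrow> F b \<noteq> 0 \<longrightarrow> F a \<noteq> F b \<and> (F a < F b \<longleftrightarrow> {F a, F b} \<notin> C)) \<and>
     (\<forall>a. F a \<noteq> 0 \<longrightarrow> i \<le> F a) \<and> (\<forall>p q. {p, q} \<in> C \<longrightarrow> i \<le> p)"

lemma crossing_record_entry:
  assumes "crossing_record (Suc i) F C" "e = 0 \<or> e = i"
  shows "crossing_record i (case_nat e F) C"
proof -
  have "F a \<noteq> 0 \<Longrightarrow> i < F a" for a
    using assms(1) by (auto simp: crossing_record_def Suc_le_eq)
  moreover have "{i, q} \<notin> C" for q
    using assms(1) by (auto simp: crossing_record_def)
  moreover have "{p, q} \<in> C \<Longrightarrow> i \<le> p" for p q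
    using assms(1) unfolding crossing_record_def by (metis Suc_leD)
  ultimately show ?thesis
    using assms unfolding crossing_record_def
    by (auto split: nat.splits simp: less_Suc_eq_0_disj less_imp_le)
qed

lemma crossing_record_cross:
  assumes C: "crossing_record i F C" and nz: "F k \<noteq> 0" "F (Suc k) \<noteq> 0"
  shows "crossing_record i (cell_op CrossT k F) (insert {F k, F (Suc k)} C)"
    and "{F k, F (Suc k)} \<notin> C \<longleftrightarrow> F k < F (Suc k)"
proof -
  let ?p = "F k" and ?q = "F (Suc k)"
  have ord: "F a \<noteq> F b \<and> (F a < F b \<longleftrightarrow> {F a, F b} \<notin> C)" if "a < b" "F a \<noteq> 0" "F b \<noteq> 0" for a b
    using C that unfolding crossing_record_def by blast
  have inj: "a = b" if "F a = F b" "F a \<noteq> 0" for a b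
    using ord[of a b] ord[of b a] that by (cases a b rule: linorder_cases) auto
  show pq: "{?p, ?q} \<notin> C \<longleftrightarrow> ?p < ?q"
    using ord[of k "Suc k"] nz by simp
  show "crossing_record i (cell_op CrossT k F) (insert {?p, ?q} C)"
  proof (cases "?p < ?q")
    case True
    let ?t = "transpose k (Suc k)"
    have F': "cell_op CrossT k F = F \<circ> ?t"
      using True by (auto simp: cell_op_def transpose_def)
    have "F (?t a) \<noteq> F (?t b) \<and> (F (?t a) < F (?t b) \<longleftrightarrow> {F (?t a), F (?t b)} \<notin> insert {?p, ?q} C)"
      if ab: "a < b" "F (?t a) \<noteq> 0" "F (?t b) \<noteq> 0" for a b
    proof (cases "a = k \<and> b = Suc k")
      case True
      then show ?thesis using \<open>?p < ?q\<close> by (auto simp: insert_commute)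
    next
      case False
      then have lt: "?t a < ?t b"
        using ab(1) by (auto simp: transpose_def)
      have "\<not> (?t a = k \<and> ?t b = Suc k)"
        using ab(1) by (auto simp: transpose_def split: if_splits)
      then have "{F (?t a), F (?t b)} \<noteq> {?p, ?q}"
        using inj ab lt nz by (metis doubleton_eq_iff lessI less_asym)
      then show ?thesis using ord[OF lt ab(2,3)] by simp
    qed
    moreover have "F a \<noteq> 0 \<Longrightarrow> i \<le> F a" for a
      using C unfolding crossing_record_def by blast
    moreover have "{p, q} \<in> C \<Longrightarrow> i \<le> p" for p q
      using C unfolding crossing_record_def by blast
    ultimately show ?thesis
      unfolding F' crossing_record_def using nz by (auto simp: doubleton_eq_iff)
  next
    case False
    then show ?thesis
      using pq C by (simp add: cell_op_def insert_absorb)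
  qed
qed

text \<open>
  Passing an H-tile moves a pipe past a position without pipe, so the order of the actual pipes is kept.
\<close>

lemma crossing_record_horizontal:
  assumes "crossing_record i F C" "F (Suc k) = 0"
  shows "crossing_record i (cell_op HT k F) C"
proof -
  have F': "cell_op HT k F = (\<lambda>a. F (transpose k (Suc k) a))"
    by (auto simp: cell_op_def transpose_def)
  have "transpose k (Suc k) a < transpose k (Suc k) b"
    if "a < b" "F (transpose k (Suc k) a) \<noteq> 0" "F (transpose k (Suc k) b) \<noteq> 0" for a b
    using that assms(2) by (auto simp: transpose_def split: if_splits)
  then show ?thesis
    using assms(1) unfolding F' crossing_record_def by blast
qed

text \<open>
  At a cross the pair is uncrossed exactly if the left pipe is the smaller one, by the invariant
  \<open>crossing_record\<close>; hence the tracing rule acts on the front as \<open>cell_op\<close> does.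
\<close>

lemma trace_state_front:
  assumes "tiling n m T" and "d < n" "k \<le> m" and "trace_state n m T d k = (h, v, C)"
  shows "(\<forall>a. front n m T d k a = (if a < k then v (Suc a) else if a = k then h else v a)) \<and>
    crossing_record (n - d) (front n m T d k) C"
  using assms
proof (induction n m T d k arbitrary: h v C rule: front.induct[case_names first row cell])
  case (first n m T)
  then show ?case
    by (auto simp: crossing_record_def entry_def split: nat.split if_splits)
next
  case (row n m T d)
  obtain h' where st: "trace_state n m T d m = (h', v, C)"
    using row.prems by (cases "trace_state n m T d m") auto
  then have IH: "\<And>a. front n m T d m a = (if a < m then v (Suc a) else if a = m then h' else v a)"
    "crossing_record (n - d) (front n m T d m) C"
    using row.IH[of h' v C] row.prems by auto
  have "front n m T d m a = v (Suc a)" for a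
  proof (cases "a < m")
    case False
    then have "front n m T d m a = 0" "front n m T d m (Suc a) = 0"
      using front_edges[of n m T d m] row.prems by (cases "a = m"; simp)+
    then show ?thesis using IH(1)[of "Suc a"] False by simp
  qed (use IH in simp)
  moreover have "crossing_record (n - Suc d) (front n m T (Suc d) 0) C"
    using crossing_record_entry[of "n - Suc d" _ C "entry T (n - Suc d)"] IH(2) row.prems
    by (auto simp: entry_def Suc_diff_Suc)
  ultimately show ?case
    using row.prems st by (auto split: nat.split)
next
  case (cell n m T d k)
  let ?F = "front n m T d k" and ?t = "T (n - d) (Suc k)"
  obtain h' v' C' where st: "trace_state n m T d k = (h', v', C')"
    by (cases "trace_state n m T d k")
  then have IH: "\<And>a. ?F a = (if a < k then v' (Suc a) else if a = k then h' else v' a)"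
    "crossing_record (n - d) ?F C'"
    using cell.IH[OF cell.prems(1,2) _ st] cell.prems by auto
  have hv: "h' = ?F k" "v' (Suc k) = ?F (Suc k)"
    using IH(1) by auto
  have k: "?F k \<noteq> 0 \<longleftrightarrow> LeftE \<in> edges ?t" "?F (Suc k) \<noteq> 0 \<longleftrightarrow> BottomE \<in> edges ?t"
    using front_edges[of n m T d k] cell.prems by auto
  have "trace_tile ?t (?F k) (?F (Suc k)) C' = (cell_op ?t k ?F k, cell_op ?t k ?F (Suc k), C) \<and>
      crossing_record (n - d) (cell_op ?t k ?F) C"
  proof (cases ?t)
    case CrossT
    then show ?thesis
      using crossing_record_cross[OF IH(2), of k] k cell.prems st hv
      by (auto simp: cell_op_def insert_absorb split: if_splits)
  next
    case HT
    then show ?thesis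
      using crossing_record_horizontal[OF IH(2), of k] k cell.prems st hv by (auto simp: cell_op_def)
  qed (use k cell.prems st hv IH(2) in \<open>auto simp: cell_op_def\<close>)
  moreover from this have "h = cell_op ?t k ?F (Suc k)" "v = v'(Suc k := cell_op ?t k ?F k)"
    using cell.prems st hv by auto
  moreover have "cell_op ?t k ?F a = ?F a" if "a \<noteq> k" "a \<noteq> Suc k" for a
    using that by (simp add: cell_op_def)
  ultimately show ?case
    using IH(1) by auto
qed

lemma exit_pipe_front:
  assumes "tiling n m T" "n \<ge> 1" "c \<in> {1..m}"
  shows "exit_pipe n m T c = front n m T (n - 1) m (c - 1)"
proof -
  obtain h v C where st: "trace_state n m T (n - 1) m = (h, v, C)"
    by (cases "trace_state n m T (n - 1) m")
  then show ?thesis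
    using trace_state_front[OF assms(1) _ _ st] assms exit_pipe_trace_state[of n m T c] by auto
qed

declare front.simps [simp del]

section \<open>The staircase shape of pipe dreams\<close>

definition triangle :: "nat \<Rightarrow> (nat \<times> nat) set" where
  "triangle n = {(i, j). 1 \<le> i \<and> 1 \<le> j \<and> i + j \<le> n}"

text \<open>
  The boundary conditions force the staircase shape of a pipe dream, so that the set of its cross cells
  is the only freedom left.
\<close>

definition pd_of :: "nat \<Rightarrow> (nat \<times> nat) set \<Rightarrow> nat \<Rightarrow> nat \<Rightarrow> tile" where
  "pd_of n D i j =
     (if i = 0 \<or> j = 0 \<or> i + j > Suc n then BlankT
      else if i + j = Suc n then JT
      else if (i, j) \<in> D then CrossT else BumpT)"

lemma finite_triangle: "finite (triangle n)"
  by (rule finite_subset[of _ "{..n} \<times> {..n}"]) (auto simp: triangle_def)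

lemma edges_pd_of:
  assumes "i \<ge> 1" "j \<ge> 1"
  shows "LeftE \<in> edges (pd_of n D i j) \<longleftrightarrow> i + j \<le> Suc n"
    and "TopE \<in> edges (pd_of n D i j) \<longleftrightarrow> i + j \<le> Suc n"
    and "RightE \<in> edges (pd_of n D i j) \<longleftrightarrow> i + j \<le> n"
    and "BottomE \<in> edges (pd_of n D i j) \<longleftrightarrow> i + j \<le> n"
  using assms by (auto simp: pd_of_def)

lemma pipe_dream_pd_of: "pipe_dream n (pd_of n D)"
proof -
  have "tiling n n (pd_of n D)"
    unfolding tiling_def by (auto simp: edges_pd_of) (auto simp: pd_of_def)
  then show ?thesis
    unfolding pipe_dream_def by (auto simp: edges_pd_of) (auto simp: pd_of_def split: if_splits)
qed

lemma wty_pd_of: "D \<subseteq> triangle n \<Longrightarrow> wty_PD n (pd_of n D) = D"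
  by (auto simp: wty_PD_def cells_with_def pd_of_def triangle_def split: if_splits)

text \<open>
  Rows are determined from bottom to top: the row below fixes which cells of a row have a bottom edge,
  and then the left edges propagate from the boundary up to the J-tile.
\<close>

lemma pd_of_wty:
  assumes "pipe_dream n P"
  shows "pd_of n (wty_PD n P) = P"
proof -
  let ?Q = "pd_of n (wty_PD n P)"
  have til: "tiling n n P"
    and ran: "\<And>i j. 1 \<le> i \<Longrightarrow> i \<le> n \<Longrightarrow> 1 \<le> j \<Longrightarrow> j \<le> n \<Longrightarrow> P i j \<in> {CrossT, BumpT, JT, BlankT}"
    and left: "\<And>i. 1 \<le> i \<Longrightarrow> i \<le> n \<Longrightarrow> LeftE \<in> edges (P i 1)"
    using assms by (auto simp: pipe_dream_def)
  have row: "\<forall>j. 1 \<le> j \<longrightarrow> j \<le> n \<longrightarrow> P (n - d) j = ?Q (n - d) j" if "d < n" for d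
    using that
  proof (induction d)
    case (0)
    have bot: "BottomE \<notin> edges (P n j)" if "1 \<le> j" "j \<le> n" for j
      using tilingD(5)[OF til that] .
    have J: "P n 1 = JT"
      using ran[of n 1] left[of n] bot[of 1] 0 by auto
    have "P n j = ?Q n j" if "1 \<le> j" "j \<le> n" for j
      using that
    proof (induction j rule: dec_induct)
      case base
      then show ?case using J by (simp add: pd_of_def)
    next
      case (step j)
      then have "LeftE \<notin> edges (P n (Suc j))"
        using tilingD(2)[OF til, of n j] edges_pd_of[of n j n] by simp
      then show ?case
        using ran[of n "Suc j"] bot[of "Suc j"] step by (auto simp: pd_of_def)
    qed
    then show ?case by simp
  next
    case (Suc d)
    let ?i = "n - Suc d"
    have bot: "BottomE \<in> edges (P ?i j) \<longleftrightarrow> j \<le> Suc d" if "1 \<le> j" "j \<le> n" for j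
    proof -
      have "BottomE \<in> edges (P ?i j) \<longleftrightarrow> TopE \<in> edges (P (n - d) j)"
        using tilingD(3)[OF til, of ?i j] that Suc.prems by (simp add: Suc_diff_Suc)
      also have "\<dots> \<longleftrightarrow> n - d + j \<le> Suc n"
        using Suc that edges_pd_of[of "n - d" j n] by simp
      finally show ?thesis using Suc.prems by auto
    qed
    have cell: "P ?i j = ?Q ?i j" if "LeftE \<in> edges (P ?i j) \<longleftrightarrow> j \<le> Suc (Suc d)" "1 \<le> j" "j \<le> n" for j
    proof -
      have i: "1 \<le> ?i" "?i \<le> n" using Suc.prems by auto
      consider "j \<le> Suc d" | "j = Suc (Suc d)" | "j > Suc (Suc d)" by linarith
      then show ?thesis
      proof cases
        case 1
        then have "P ?i j \<in> {CrossT, BumpT}"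
          using ran[OF i that(2,3)] that bot[of j] Suc.prems 1 by auto
        then show ?thesis
          using 1 that Suc.prems by (auto simp: pd_of_def wty_PD_def cells_with_def)
      qed (use ran[OF i that(2,3)] that bot[of j] Suc.prems in \<open>auto simp: pd_of_def\<close>)
    qed
    have "P ?i j = ?Q ?i j" if "1 \<le> j" "j \<le> n" for j
      using that
    proof (induction j rule: dec_induct)
      case base
      then show ?case using cell[of 1] left[of ?i] Suc.prems by simp
    next
      case (step j)
      then have "LeftE \<in> edges (P ?i (Suc j)) \<longleftrightarrow> ?i + j \<le> n"
        using tilingD(2)[OF til, of ?i j] edges_pd_of[of ?i j n] Suc.prems by simp
      then have "LeftE \<in> edges (P ?i (Suc j)) \<longleftrightarrow> Suc j \<le> Suc (Suc d)"
        using Suc.prems by auto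
      then show ?case
        using cell[of "Suc j"] step by simp
    qed
    then show ?case by blast
  qed
  have "P i j = ?Q i j" for i j
  proof (cases "i \<in> {1..n} \<and> j \<in> {1..n}")
    case True
    then show ?thesis using row[of "n - i"] by auto
  next
    case False
    then show ?thesis using tilingD(1)[OF til False] by (auto simp: pd_of_def)
  qed
  then show ?thesis by (simp add: fun_eq_iff)
qed

abbreviation pd_front :: "nat \<Rightarrow> (nat \<times> nat) set \<Rightarrow> nat \<Rightarrow> nat \<Rightarrow> nat \<Rightarrow> nat" where
  "pd_front n D \<equiv> front n n (pd_of n D)"

lemma pd_front_row:
  assumes "Suc d < n"
  shows "pd_front n D (Suc d) 0 = case_nat (n - Suc d) (pd_front n D d n)"
  using assms edges_pd_of(1)[of "n - Suc d" 1 n] by (simp add: front.simps(1,2) entry_def)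

lemma pd_front_first: "n \<ge> 1 \<Longrightarrow> pd_front n D 0 0 = case_nat n (\<lambda>_. 0)"
  using edges_pd_of(1)[of n 1 n] by (simp add: front.simps(1,2) entry_def)

lemma pd_front_cell:
  assumes "d < n"
  shows "pd_front n D d (Suc k) = (let F = pd_front n D d k in
    if k < d \<and> (n - d, Suc k) \<in> D \<and> F k < F (Suc k) then F(k := F (Suc k), Suc k := F k) else F)"
proof -
  have "pd_of n D (n - d) (Suc k) \<noteq> HT"
    by (auto simp add: pd_of_def)
  moreover have "pd_of n D (n - d) (Suc k) = CrossT \<longleftrightarrow> k < d \<and> (n - d, Suc k) \<in> D"
    using assms by (auto simp: pd_of_def)
  ultimately show ?thesis
    by (simp add: front.simps(3) cell_op_def Let_def)
qed

lemma pd_front_induct [consumes 1, case_names first row cell]: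
  assumes "d < n"
    and "P 0 0"
    and "\<And>d. Suc d < n \<Longrightarrow> P d n \<Longrightarrow> P (Suc d) 0"
    and "\<And>d k. d < n \<Longrightarrow> P d k \<Longrightarrow> P d (Suc k)"
  shows "P d (k::nat)"
proof -
  have row: "P d k" if "d < n" "P d 0" for d k
    using that by (induction k) (simp_all add: assms(4))
  show ?thesis
    using assms(1)
  proof (induction d arbitrary: k)
    case 0
    then show ?case using row[of 0] assms(2) by simp
  next
    case (Suc d)
    then show ?case using row[of "Suc d"] assms(3)[of d] by simp
  qed
qed

lemma pd_front_bij:
  assumes "d < n"
  shows "bij_betw (pd_front n D d k) {..d} {n - d..n} \<and> (\<forall>a>d. pd_front n D d k a = 0)"
  using assms
proof (induction d k rule: pd_front_induct)
  case first
  then show ?case using assms by (auto simp: pd_front_first bij_betw_def split: nat.split)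
next
  case (row d)
  let ?F = "pd_front n D d n"
  have F: "inj_on ?F {..d}" "?F ` {..d} = {n - d..n}"
    using row by (auto simp: bij_betw_def)
  have dom: "{..Suc d} = insert 0 (Suc ` {..d})"
    by (simp add: atMost_Suc_eq_insert_0)
  have "inj_on (case_nat (n - Suc d) ?F) {..Suc d}"
  proof -
    have "n - Suc d \<notin> ?F ` {..d}" using F row by auto
    then show ?thesis
      using F(1) unfolding dom by (auto simp: inj_on_def image_iff) (metis atMost_iff)
  qed
  moreover have "case_nat (n - Suc d) ?F ` {..Suc d} = {n - Suc d..n}"
  proof -
    have "{n - Suc d..n} = insert (n - Suc d) {n - d..n}"
      using row.hyps by auto
    then show ?thesis
      using F(2) unfolding dom image_insert image_image by simp
  qed
  ultimately show ?case
    using row by (auto simp: bij_betw_def pd_front_row split: nat.split)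
next
  case (cell d k)
  let ?F = "pd_front n D d k"
  show ?case
  proof (cases "k < d \<and> (n - d, Suc k) \<in> D \<and> ?F k < ?F (Suc k)")
    case True
    have "transpose k (Suc k) permutes {..d}"
      using True by (intro permutes_swap_id) auto
    then have "bij_betw (?F \<circ> transpose k (Suc k)) {..d} {n - d..n}"
      using bij_betw_trans[OF permutes_imp_bij] cell by blast
    moreover have "pd_front n D d (Suc k) = ?F \<circ> transpose k (Suc k)"
      using True cell.hyps by (auto simp: pd_front_cell Let_def transpose_def)
    moreover have "pd_front n D d (Suc k) a = 0" if "a > d" for a
      using cell True that by (simp add: pd_front_cell Let_def)
    ultimately show ?thesis
      by metis
  next
    case False
    then show ?thesis
      using cell by (auto simp: pd_front_cell Let_def)
  qed
qed

section \<open>Records of the exit sequence\<close>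

definition before :: "(nat \<Rightarrow> nat) \<Rightarrow> nat \<Rightarrow> nat \<Rightarrow> bool" where
  "before F x y \<longleftrightarrow> (\<exists>a b. a < b \<and> F a = x \<and> F b = y)"

text \<open>
  A cross only ever turns an increasing neighbouring pair into a decreasing one, so a pair that is already
  in decreasing order stays so. This one-sided persistence is the key to everything about records below.
\<close>

lemma before_cell:
  assumes "before (pd_front n D d k) x y" "y < x" "d < n"
  shows "before (pd_front n D d (Suc k)) x y"
proof -
  let ?F = "pd_front n D d k" and ?t = "transpose k (Suc k)"
  obtain a b where ab: "a < b" "?F a = x" "?F b = y"
    using assms(1) by (auto simp: before_def)
  show ?thesis
  proof (cases "k < d \<and> (n - d, Suc k) \<in> D \<and> ?F k < ?F (Suc k)")
    case True
    then have F': "pd_front n D d (Suc k) = ?F \<circ> ?t"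
      using assms(3) by (auto simp: pd_front_cell Let_def transpose_def)
    have "\<not> (a = k \<and> b = Suc k)"
      using ab True assms(2) by auto
    then have "?t a < ?t b"
      using ab(1) by (auto simp: transpose_def)
    then show ?thesis
      using ab unfolding F' before_def by (intro exI[of _ "?t a"] exI[of _ "?t b"]) simp
  next
    case False
    then show ?thesis
      using assms by (auto simp: pd_front_cell Let_def)
  qed
qed

lemma before_row: "before F x y \<Longrightarrow> before (case_nat e F) x y"
proof -
  assume "before F x y"
  then obtain a b where "a < b" "F a = x" "F b = y"
    by (auto simp: before_def)
  then show ?thesis
    unfolding before_def by (intro exI[of _ "Suc a"] exI[of _ "Suc b"]) simp
qed

lemma before_final:
  assumes "before (pd_front n D d k) x y" "y < x" "d < n" "k \<le> n"
  shows "before (pd_front n D (n - 1) n) x y"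
proof -
  have row: "before (pd_front n D d n) x y" if "k \<le> n" "before (pd_front n D d k) x y" "d < n" for d k
    using that
  proof (induction rule: inc_induct)
    case (step k)
    then show ?case using before_cell[OF step.prems(1) assms(2)] by simp
  qed simp
  have "d \<le> n - 1" using assms by simp
  then show ?thesis
    using assms(1,4)
  proof (induction arbitrary: k rule: inc_induct)
    case base
    then show ?case using row[of k "n - 1"] assms(3) by simp
  next
    case (step d)
    then have "before (pd_front n D d n) x y"
      using row[of k d] by simp
    then have "before (pd_front n D (Suc d) 0) x y"
      using before_row step.hyps assms(3) by (simp add: pd_front_row)
    then show ?case using step.IH by simp
  qed
qed

definition records :: "nat \<Rightarrow> (nat \<Rightarrow> nat) \<Rightarrow> nat set" where
  "records n v = {v a |a. a < n \<and> (\<forall>b<a. v b < v a)}"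

text \<open>
  \<open>D\<close> is the set of crosses of a pipe dream whose exiting pipes, from left to right, are
  \<open>v 0, \<dots>, v (n - 1)\<close>. For a permutation \<open>w\<close>, this is used with \<open>v a = inv w (Suc a)\<close>.
\<close>

definition realizes :: "nat \<Rightarrow> (nat \<times> nat) set \<Rightarrow> (nat \<Rightarrow> nat) \<Rightarrow> bool" where
  "realizes n D v \<longleftrightarrow> D \<subseteq> triangle n \<and> (\<forall>a<n. pd_front n D (n - 1) n a = v a)"

lemma final_front_bij:
  assumes "n \<ge> 1"
  shows "bij_betw (pd_front n D (n - 1) n) {..<n} {1..n}"
proof -
  have "{..n - 1} = {..<n}" "n - (n - 1) = 1"
    using assms by auto
  then show ?thesis
    using pd_front_bij[of "n - 1" n D n] assms by (metis diff_less less_eq_Suc_le One_nat_def zero_less_Suc)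
qed

lemma realizes_bij:
  assumes "realizes n D v" "n \<ge> 1"
  shows "bij_betw v {..<n} {1..n}"
proof -
  have eq: "pd_front n D (n - 1) n a = v a" if "a \<in> {..<n}" for a
    using assms(1) that by (simp add: realizes_def)
  show ?thesis
    using final_front_bij[OF assms(2), of D] bij_betw_cong[of "{..<n}" "pd_front n D (n - 1) n" v, OF eq]
    by simp
qed

lemma zero_not_record:
  assumes "realizes n D v" "n \<ge> 1"
  shows "0 \<notin> records n v"
proof
  assume "0 \<in> records n v"
  then obtain a where "a < n" "v a = 0"
    by (auto simp: records_def)
  then show False
    using bij_betw_apply[OF realizes_bij[OF assms], of a] by simp
qed

text \<open>
  A decreasing pair on some front would survive to the final front \<open>v\<close>, where nothing larger precedes
  a record. So a record pipe never crosses a larger pipe.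
\<close>

lemma no_larger_before_record:
  assumes D: "realizes n D v" and "d < n" "k \<le> n" and r: "r \<in> records n v" and "r < x"
  shows "\<not> before (pd_front n D d k) x r"
proof
  assume "before (pd_front n D d k) x r"
  then have "before (pd_front n D (n - 1) n) x r"
    using before_final assms by blast
  then obtain a b where ab: "a < b" "pd_front n D (n - 1) n a = x" "pd_front n D (n - 1) n b = r"
    by (auto simp: before_def)
  obtain c where c: "c < n" "v c = r" "\<forall>b<c. v b < v c"
    using r by (auto simp: records_def)
  have v: "bij_betw v {..<n} {1..n}"
    using realizes_bij[OF D] \<open>d < n\<close> by simp
  then have "r \<noteq> 0"
    using c(2) bij_betw_apply[OF v, of c] c(1) by auto
  then have "b < n"
    using pd_front_bij[of "n - 1" n D n] \<open>d < n\<close> ab(3) by (cases "b > n - 1") auto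
  then have "v a = x" "v b = r" "a < n"
    using ab D by (auto simp: realizes_def)
  moreover from this have "b = c"
    using v c \<open>b < n\<close> by (auto simp: bij_betw_def inj_on_def)
  ultimately show False
    using c(3) ab(1) \<open>r < x\<close> by auto
qed

section \<open>Counting bumps\<close>

definition bumps_under :: "nat \<Rightarrow> (nat \<times> nat) set \<Rightarrow> nat set \<Rightarrow> (nat \<times> nat) set" where
  "bumps_under n D R = {(i, j) \<in> triangle n - D. pd_front n D (n - i) (j - 1) j \<in> R}"

text \<open>
  The sum of the positions of the elements of \<open>R\<close> on the front, where positions beyond the current
  one are lowered by one. The shift makes the sum invariant when a new row begins.
\<close>

definition potential :: "nat \<Rightarrow> nat set \<Rightarrow> (nat \<Rightarrow> nat) \<Rightarrow> nat \<Rightarrow> nat" where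
  "potential n R F k = (\<Sum>a\<le>n. if F a \<in> R then (if a \<le> k then a else a - 1) else 0)"

lemma sum_change_two:
  fixes g h :: "nat \<Rightarrow> nat"
  assumes "Suc k \<le> n" "\<And>a. a \<noteq> k \<Longrightarrow> a \<noteq> Suc k \<Longrightarrow> g a = h a"
  shows "(\<Sum>a\<le>n. g a) + (h k + h (Suc k)) = (\<Sum>a\<le>n. h a) + (g k + g (Suc k))"
proof -
  have split: "sum f {..n} = f k + f (Suc k) + sum f ({..n} - {k, Suc k})" for f :: "nat \<Rightarrow> nat"
    using assms(1) sum.subset_diff[of "{k, Suc k}" "{..n}" f] by simp
  have "sum g ({..n} - {k, Suc k}) = sum h ({..n} - {k, Suc k})"
    by (rule sum.cong) (use assms(2) in auto)
  then show ?thesis using split[of g] split[of h] by simp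
qed

lemma pd_front_neq:
  assumes "d < n" "k < d"
  shows "pd_front n D d k k \<noteq> pd_front n D d k (Suc k)"
  using pd_front_bij[OF assms(1), of D k] assms(2)
    inj_on_eq_iff[of "pd_front n D d k" "{..d}" k "Suc k"] by (simp add: bij_betw_def)

text \<open>
  Behind a cross the smaller pipe follows the larger one, which a record never does.
\<close>

lemma min_at_cross_not_record:
  assumes D: "realizes n D v" and d: "d < n" and k: "k < d" "(n - d, Suc k) \<in> D"
  shows "min (pd_front n D d k k) (pd_front n D d k (Suc k)) \<notin> records n v"
proof -
  let ?F = "pd_front n D d k" and ?F' = "pd_front n D d (Suc k)"
  have "before ?F' (max (?F k) (?F (Suc k))) (min (?F k) (?F (Suc k)))"
    unfolding before_def using d k
    by (intro exI[of _ k] exI[of _ "Suc k"]) (auto simp: pd_front_cell Let_def)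
  moreover have "min (?F k) (?F (Suc k)) < max (?F k) (?F (Suc k))"
    using pd_front_neq[OF d k(1), of D] by auto
  ultimately show ?thesis
    using no_larger_before_record[OF D d, of "Suc k"] d k(1) by (meson less_trans Suc_leI)
qed

text \<open>
  Advancing by one column takes away the shift of the right label, so the potential grows by one if that
  label is a record which was the bottom label before. At a bump, this is the case when the
  bottom pipe is a record. At a cross, the smaller pipe leaves on the right, and it is not a record; the
  larger pipe leaves at the top and contributes as before.
\<close>

lemma potential_cell:
  assumes D: "realizes n D v" and d: "d < n" and k: "k < n"
  defines "R \<equiv> records n v" and "F \<equiv> pd_front n D d k" and "F' \<equiv> pd_front n D d (Suc k)"
  shows "potential n R F' (Suc k) =
    potential n R F k + (if (n - d, Suc k) \<in> bumps_under n D R then 1 else 0)"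
proof -
  have n: "n \<ge> 1" using d by simp
  have "0 \<notin> R"
    using zero_not_record[OF D n] by (simp add: R_def)
  have tri: "(n - d, Suc k) \<in> triangle n \<longleftrightarrow> k < d"
    using d by (auto simp: triangle_def)
  have bump: "(n - d, Suc k) \<in> bumps_under n D R \<longleftrightarrow>
      k < d \<and> (n - d, Suc k) \<notin> D \<and> F (Suc k) \<in> R"
    using d tri by (auto simp: bumps_under_def F_def)
  let ?g = "\<lambda>a. if F' a \<in> R then (if a \<le> Suc k then a else a - 1) else 0"
  let ?h = "\<lambda>a. if F a \<in> R then (if a \<le> k then a else a - 1) else 0"
  have "F' a = F a" if "a \<noteq> k" "a \<noteq> Suc k" for a
    using that d by (simp add: F_def F'_def pd_front_cell Let_def)
  then have eq: "potential n R F' (Suc k) + (?h k + ?h (Suc k)) = potential n R F k + (?g k + ?g (Suc k))"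
    unfolding potential_def by (intro sum_change_two) (use k in auto)
  have F': "F' = (if k < d \<and> (n - d, Suc k) \<in> D \<and> F k < F (Suc k)
      then F(k := F (Suc k), Suc k := F k) else F)"
    using d by (simp add: F_def F'_def pd_front_cell Let_def)
  have low: "min (F k) (F (Suc k)) \<notin> R" if "k < d" "(n - d, Suc k) \<in> D"
    using min_at_cross_not_record[OF D d that] by (simp add: F_def R_def)
\<comment> \<open>crosses with and without effect, bumps, and the cells from the J-tile on\<close>
    consider "k < d" "(n - d, Suc k) \<in> D" "F k < F (Suc k)"
    | "k < d" "(n - d, Suc k) \<in> D" "F (Suc k) < F k"
    | "k < d" "(n - d, Suc k) \<notin> D" | "d \<le> k"
    using pd_front_neq[OF d, of k D] unfolding F_def by linarith
  then show ?thesis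
  proof cases
    case 1
    then have "F k \<notin> R" using low by (simp add: min_def)
    then show ?thesis using eq 1 bump by (auto simp: F' split: if_splits)
  next
    case 2
    then have "F (Suc k) \<notin> R" using low by (simp add: min_def)
    then show ?thesis using eq 2 bump by (auto simp: F' split: if_splits)
  next
    case 3
    then show ?thesis using eq bump by (auto simp: F' split: if_splits)
  next
    case 4
    then have "F (Suc k) = 0"
      using pd_front_bij[OF d, of D k] by (simp add: F_def)
    then show ?thesis using eq 4 bump \<open>0 \<notin> R\<close> by (auto simp: F' split: if_splits)
  qed
qed

lemma potential_row:
  assumes "F n \<notin> R"
  shows "potential n R (case_nat e F) 0 = potential n R F n"
proof -
  have "potential n R F n = (\<Sum>a<n. if F a \<in> R then a else 0)"
    using assms unfolding potential_def
    by (auto simp: lessThan_Suc_atMost[symmetric] intro!: sum.cong)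
  moreover have "potential n R (case_nat e F) 0 = (\<Sum>a<n. if F a \<in> R then a else 0)"
    unfolding potential_def by (auto simp: sum.atMost_shift intro!: sum.cong)
  ultimately show ?thesis by simp
qed

lemma potential_eq_card:
  assumes D: "realizes n D v" and "d < n" "k \<le> n"
  defines "R \<equiv> records n v"
  shows "potential n R (pd_front n D d k) k =
    card {(i, j) \<in> bumps_under n D R. n - i < d \<or> n - i = d \<and> j \<le> k}"
  using assms(2,3)
proof (induction d k rule: pd_front_induct)
  case first
  have n: "n \<ge> 1" using assms(2) by simp
  have R0: "0 \<notin> R"
    using zero_not_record[OF D n] by (simp add: R_def)
  have "potential n R (pd_front n D 0 0) 0 = 0"
    using R0 unfolding potential_def pd_front_first[OF n] by (intro sum.neutral) (auto split: nat.split)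
  moreover have "{(i, j) \<in> bumps_under n D R. n - i < 0 \<or> n - i = 0 \<and> j \<le> 0} = {}"
    by (auto simp: bumps_under_def triangle_def)
  ultimately show ?case by (simp only: card.empty)
next
  case (row d)
  have n: "n \<ge> 1" using assms(2) by simp
  have R0: "0 \<notin> R"
    using zero_not_record[OF D n] by (simp add: R_def)
  have "pd_front n D d n n = 0"
    using pd_front_bij[of d n D n] row.hyps by simp
  then have "potential n R (pd_front n D (Suc d) 0) 0 = potential n R (pd_front n D d n) n"
    using potential_row[of "pd_front n D d n" n R] R0 row.hyps by (simp add: pd_front_row)
  moreover have "{(i, j) \<in> bumps_under n D R. n - i < d \<or> n - i = d \<and> j \<le> n} =
      {(i, j) \<in> bumps_under n D R. n - i < Suc d \<or> n - i = Suc d \<and> j \<le> 0}"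
    by (auto simp: bumps_under_def triangle_def)
  ultimately show ?case
    using row by simp
next
  case (cell d k)
  let ?B = "bumps_under n D R"
  let ?S = "\<lambda>k. {(i, j) \<in> ?B. n - i < d \<or> n - i = d \<and> j \<le> k}"
  have "?B \<subseteq> triangle n" by (auto simp: bumps_under_def)
  have "?S (Suc k) = (if (n - d, Suc k) \<in> ?B then insert (n - d, Suc k) (?S k) else ?S k)"
    using cell.hyps \<open>?B \<subseteq> triangle n\<close> by (auto simp: le_Suc_eq triangle_def)
  moreover have "finite (?S k)"
    by (rule finite_subset[OF _ finite_triangle[of n]]) (use \<open>?B \<subseteq> triangle n\<close> in auto)
  moreover have "(n - d, Suc k) \<notin> ?S k"
    using cell.hyps by simp
  ultimately have "card (?S (Suc k)) = card (?S k) + (if (n - d, Suc k) \<in> ?B then 1 else 0)"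
    by simp
  then show ?case
    using potential_cell[OF D cell.hyps(1), of k] cell by (simp add: R_def)
qed

text \<open>
  These bumps measure by how much a pipe dream fails to have the maximal number of crosses.
\<close>

definition bad_bumps :: "nat \<Rightarrow> (nat \<Rightarrow> nat) \<Rightarrow> (nat \<times> nat) set \<Rightarrow> (nat \<times> nat) set" where
  "bad_bumps n v D = {(i, j) \<in> triangle n - D. pd_front n D (n - i) (j - 1) j \<notin> records n v}"

text \<open>
  The number of bumps with a record below equals the final potential, which depends on \<open>v\<close> only. Hence
  a pipe dream has more crosses the fewer bad bumps it has.
\<close>

lemma card_crosses:
  assumes D: "realizes n D v" and n: "n \<ge> 1"
  shows "card D + card (bad_bumps n v D) + (\<Sum>a<n. if v a \<in> records n v then a else 0) =
    card (triangle n)"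
proof -
  let ?R = "records n v" and ?F = "pd_front n D (n - 1) n"
  let ?G = "bumps_under n D ?R" and ?B = "bad_bumps n v D"
  have R0: "0 \<notin> ?R"
    using zero_not_record[OF D n] .
  have "?F n = 0" using pd_front_bij[of "n - 1" n D n] n by simp
  have "potential n ?R ?F n = card {(i, j) \<in> ?G. n - i < n - 1 \<or> n - i = n - 1 \<and> j \<le> n}"
    using potential_eq_card[OF D, of "n - 1" n] n by simp
  also have "{(i, j) \<in> ?G. n - i < n - 1 \<or> n - i = n - 1 \<and> j \<le> n} = ?G"
    by (auto simp: bumps_under_def triangle_def)
  also have "potential n ?R ?F n = (\<Sum>a<n. if v a \<in> ?R then a else 0)"
    using D \<open>?F n = 0\<close> R0 unfolding potential_def
    by (auto simp: lessThan_Suc_atMost[symmetric] realizes_def intro!: sum.cong)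
  finally have G: "card ?G = (\<Sum>a<n. if v a \<in> ?R then a else 0)" ..
  have tri: "triangle n = D \<union> (?G \<union> ?B)"
    using D by (auto simp: realizes_def bumps_under_def bad_bumps_def)
  then have fin: "finite D" "finite ?G" "finite ?B"
    using finite_triangle[of n] by simp_all
  have "card (triangle n) = card D + (card ?G + card ?B)"
    unfolding tri using fin
    by (subst card_Un_disjoint, (auto simp: bumps_under_def bad_bumps_def)[3],
      subst card_Un_disjoint) (auto simp: bumps_under_def bad_bumps_def)
  then show ?thesis using G by simp
qed

section \<open>A pipe dream without bad bumps\<close>

text \<open>
  A kept element \<open>y\<close> whose predecessor is removed was preceded by something smaller, so \<open>y \<in> R\<close> already,
  whatever its new predecessor may be. The induction therefore allows an arbitrary element in the
  place of a removed one.
\<close>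

lemma successively_filter_ge:
  fixes R :: "nat set" and i :: nat
  defines "P \<equiv> \<lambda>x y. x < y \<longrightarrow> y \<in> R"
  assumes "successively P xs"
  shows "successively P (filter (\<lambda>x. i \<le> x) xs)"
proof -
  have cons: "successively P (y # xs) \<Longrightarrow> x = y \<or> y < i \<Longrightarrow> successively P (x # filter (\<lambda>x. i \<le> x) xs)" for x y xs
  proof (induction xs arbitrary: x y)
    case (Cons z zs)
    show ?case
    proof (cases "i \<le> z")
      case True
      have "P x z" "successively P (z # zs)"
        using Cons.prems True by (auto simp: successively_Cons P_def)
      then show ?thesis
        using Cons.IH[of z z] True by (simp add: successively_Cons)
    next
      case False
      then show ?thesis
        using Cons.IH[of z x] Cons.prems by (simp add: successively_Cons)
    qed
  qed simp
  show ?thesis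
  proof (cases xs)
    case (Cons y ys)
    have "successively P (y # filter (\<lambda>x. i \<le> x) ys)"
      using cons[of y ys y] assms Cons by simp
    then show ?thesis
      using Cons by (auto simp: successively_Cons)
  qed simp
qed

text \<open>
  The final sequence restricted to the pipes that enter in one of the \<open>d + 1\<close> lowest rows; it serves as the
  front after row \<open>n - d\<close> of the pipe dream constructed here. In that row, pipe \<open>n - d\<close> runs straight to its
  place in the list, and from then on the tiles keep the front fixed, with crosses wherever a cross has no
  effect.
\<close>

definition upper_part :: "nat \<Rightarrow> (nat \<Rightarrow> nat) \<Rightarrow> nat \<Rightarrow> nat list" where
  "upper_part n v d = filter (\<lambda>x. n - d \<le> x) (map v [0..<n])"

definition min_pos :: "nat \<Rightarrow> (nat \<Rightarrow> nat) \<Rightarrow> nat \<Rightarrow> nat" where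
  "min_pos n v d = length (takeWhile (\<lambda>x. x \<noteq> n - d) (upper_part n v d))"

definition greedy_crosses :: "nat \<Rightarrow> (nat \<Rightarrow> nat) \<Rightarrow> (nat \<times> nat) set" where
  "greedy_crosses n v = {(i, j) \<in> triangle n. j \<le> min_pos n v (n - i) \<or>
     upper_part n v (n - i) ! j < upper_part n v (n - i) ! (j - 1)}"

context
  fixes n :: nat and v :: "nat \<Rightarrow> nat"
  assumes v: "bij_betw v {..<n} {1..n}"
begin

lemma distinct_upper_part: "distinct (upper_part n v d)"
  using v by (auto simp: upper_part_def distinct_map bij_betw_def lessThan_atLeast0)

lemma set_upper_part: "d < n \<Longrightarrow> set (upper_part n v d) = {n - d..n}"
  using v by (auto simp: upper_part_def bij_betw_def lessThan_atLeast0)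

lemma length_upper_part: "d < n \<Longrightarrow> length (upper_part n v d) = Suc d"
  using distinct_card[OF distinct_upper_part] set_upper_part[of d] by (metis Suc_diff_le card_atLeastAtMost diff_diff_cancel diff_le_self less_imp_le)

lemma nth_min_pos:
  assumes "d < n"
  shows "min_pos n v d \<le> d" "upper_part n v d ! min_pos n v d = n - d"
proof -
  have "n - d \<in> set (upper_part n v d)"
    using set_upper_part[OF assms] by simp
  then have "min_pos n v d < length (upper_part n v d)"
  proof -
    have "dropWhile (\<lambda>x. x \<noteq> n - d) (upper_part n v d) \<noteq> []"
      using \<open>n - d \<in> set _\<close> by (simp add: dropWhile_eq_Nil_conv)
    then show ?thesis
      using arg_cong[OF takeWhile_dropWhile_id, of length "\<lambda>x. x \<noteq> n - d" "upper_part n v d"]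
      unfolding min_pos_def length_append length_greater_0_conv[symmetric] by linarith
  qed
  then show "min_pos n v d \<le> d" "upper_part n v d ! min_pos n v d = n - d"
    using length_upper_part[OF assms] nth_length_takeWhile[of "\<lambda>x. x \<noteq> n - d" "upper_part n v d"]
    by (auto simp: min_pos_def)
qed

lemma nth_upper_part_Suc:
  assumes "Suc d < n"
  shows "upper_part n v d ! b =
    (if b < min_pos n v (Suc d) then upper_part n v (Suc d) ! b else upper_part n v (Suc d) ! Suc b)"
proof -
  let ?L = "upper_part n v" and ?i = "n - Suc d"
  have "?i \<in> set (?L (Suc d))"
    using set_upper_part[OF assms] by simp
  then obtain us ws where L: "?L (Suc d) = us @ ?i # ws"
    by (meson split_list)
  have "?i \<notin> set us" "?i \<notin> set ws"
    using distinct_upper_part[of "Suc d"] L by auto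
  have "?L d = filter (\<lambda>x. x \<noteq> ?i) (?L (Suc d))"
    using assms by (auto simp: upper_part_def intro!: filter_cong)
  also have "\<dots> = us @ ws"
  proof -
    have "filter (\<lambda>x. x \<noteq> ?i) us = us" "filter (\<lambda>x. x \<noteq> ?i) ws = ws"
      using \<open>?i \<notin> set us\<close> \<open>?i \<notin> set ws\<close> by (auto simp: filter_id_conv)
    then show ?thesis using L by simp
  qed
  finally have "?L d = us @ ws" .
  moreover have "min_pos n v (Suc d) = length us"
    using \<open>?i \<notin> set us\<close> unfolding min_pos_def L by (subst takeWhile_append2) auto
  ultimately show ?thesis
    using L by (simp add: nth_append Suc_diff_le)
qed

text \<open>
  While the row is traced up to its place in the list, the new pipe has just shifted the labels that it
  passed by one position; this explains the last case, \<open>k < a \<le> min_pos n v d\<close>.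
\<close>

lemma front_greedy_crosses:
  assumes "d < n" "k \<le> n"
  shows "pd_front n (greedy_crosses n v) d k a =
    (if d < a then 0
     else if a < k \<or> min_pos n v d < a then upper_part n v d ! a
     else if a = k then n - d
     else upper_part n v d ! (a - 1))"
  using assms
proof (induction d k arbitrary: a rule: pd_front_induct)
  case first
  then show ?case
    using assms nth_min_pos(1)[of 0] by (auto simp: pd_front_first split: nat.split)
next
  case (row d)
  show ?case
  proof (cases a)
    case 0
    then show ?thesis using row by (simp add: pd_front_row)
  next
    case (Suc b)
    have "pd_front n (greedy_crosses n v) d n b = (if d < b then 0 else upper_part n v d ! b)"
      using row by simp
    then show ?thesis
      using row.hyps Suc nth_upper_part_Suc[of d b] by (simp add: pd_front_row) 
  qed
next
  case (cell d k)
  let ?D = "greedy_crosses n v" and ?p = "min_pos n v d" and ?L = "upper_part n v d"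
  let ?F = "pd_front n ?D d k"
  have F: "?F a = (if d < a then 0 else if a < k \<or> ?p < a then ?L ! a
      else if a = k then n - d else ?L ! (a - 1))" for a
    using cell by simp
  have p: "?p \<le> d" "?L ! ?p = n - d"
    using nth_min_pos cell.hyps by auto
  show ?case
  proof (cases "k < ?p")
    case True
    then have k: "k < d" using p by simp
    then have "(n - d, Suc k) \<in> ?D"
      using True cell.hyps by (auto simp: greedy_crosses_def triangle_def)
    moreover have Fk: "?F k = n - d" "?F (Suc k) = ?L ! k"
      using F[of k] F[of "Suc k"] True k by auto
    moreover have "n - d < ?L ! k"
    proof -
      have "?L ! k \<in> {n - d..n}"
        using set_upper_part[OF cell.hyps] length_upper_part[OF cell.hyps] k nth_mem[of k ?L] by simp
      moreover have "?L ! k \<noteq> ?L ! ?p"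
        using distinct_upper_part[of d] length_upper_part[OF cell.hyps] True p(1)
        by (subst nth_eq_iff_index_eq) auto
      ultimately show ?thesis using p(2) by simp
    qed
    ultimately have "pd_front n ?D d (Suc k) = ?F(k := ?L ! k, Suc k := n - d)"
      using cell.hyps k by (simp add: pd_front_cell Let_def)
    then show ?thesis
      using F[of a] True p by auto
  next
    case False
    have F': "?F a = (if d < a then 0 else ?L ! a)" for a
    proof (cases "a < k \<or> ?p < a \<or> d < a")
      case True
      then show ?thesis using F[of a] by auto
    next
      case False
      then have "a = k" "a = ?p" using \<open>\<not> k < ?p\<close> by auto
      then show ?thesis using F[of a] p by simp
    qed
    have "\<not> (k < d \<and> (n - d, Suc k) \<in> ?D \<and> ?F k < ?F (Suc k))"
      using False cell.hyps F'[of k] F'[of "Suc k"] by (auto simp: greedy_crosses_def)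
    then have "pd_front n ?D d (Suc k) = ?F"
      using cell.hyps by (auto simp: pd_front_cell Let_def)
    then show ?thesis
      using F' False by auto
  qed
qed

lemma realizes_greedy_crosses:
  assumes "n \<ge> 1"
  shows "realizes n (greedy_crosses n v) v"
proof -
  have "v a \<ge> 1" if "a < n" for a
    using bij_betw_apply[OF v, of a] that by simp
  then have "upper_part n v (n - 1) = map v [0..<n]"
    using assms by (auto simp: upper_part_def filter_id_conv)
  then show ?thesis
    using assms front_greedy_crosses[of "n - 1" n]
    by (auto simp: realizes_def greedy_crosses_def)
qed

text \<open>
  A bump occurs only at an ascent of some \<open>upper_part\<close>, and the upper end of such an ascent is a
  record if this holds for the ascents of \<open>v\<close> itself.
\<close>

lemma no_bad_bumps_greedy_crosses:
  assumes "successively (\<lambda>x y. x < y \<longrightarrow> y \<in> records n v) (map v [0..<n])"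
  shows "bad_bumps n v (greedy_crosses n v) = {}"
proof -
  let ?D = "greedy_crosses n v"
  have "pd_front n ?D (n - i) (j - 1) j \<in> records n v"
    if ij: "(i, j) \<in> triangle n" "(i, j) \<notin> ?D" for i j
  proof -
    let ?d = "n - i" and ?L = "upper_part n v (n - i)"
    have d: "?d < n" "1 \<le> j" "j \<le> ?d"
      using ij by (auto simp: triangle_def)
    have not: "min_pos n v ?d < j" "\<not> ?L ! j < ?L ! (j - 1)"
      using ij by (auto simp: greedy_crosses_def)
    have "?L ! (j - 1) \<noteq> ?L ! j"
      using distinct_upper_part[of ?d] length_upper_part[OF d(1)] d by (subst nth_eq_iff_index_eq) auto
    then have "?L ! (j - 1) < ?L ! Suc (j - 1)"
      using not d by simp
    moreover have "successively (\<lambda>x y. x < y \<longrightarrow> y \<in> records n v) ?L"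
      using successively_filter_ge[OF assms] by (simp add: upper_part_def)
    ultimately have "?L ! Suc (j - 1) \<in> records n v"
      using successively_nth[of _ ?L "j - 1"] length_upper_part[OF d(1)] d by fastforce
    then show ?thesis
      using front_greedy_crosses[of ?d "j - 1" j] d not by simp
  qed
  then show ?thesis
    by (auto simp: bad_bumps_def)
qed

end

section \<open>Decreasing runs of fireworks sequences\<close>

lemma dec_runs_Cons: "dec_runs (x # xs) \<noteq> [] \<and> hd (hd (dec_runs (x # xs))) = x \<and> hd (dec_runs (x # xs)) \<noteq> []"
  by (induction xs arbitrary: x) (auto simp: Let_def)

lemma ascent_top_is_head:
  "Suc j < length xs \<Longrightarrow> xs ! j \<le> xs ! Suc j \<Longrightarrow> xs ! Suc j \<in> set (map hd (tl (dec_runs xs)))"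
proof (induction xs arbitrary: j rule: dec_runs.induct)
  case (3 x y zs)
  obtain r rs where rs: "dec_runs (y # zs) = r # rs" "hd r = y"
    using dec_runs_Cons[of y zs] by (cases "dec_runs (y # zs)") auto
  show ?case
  proof (cases j)
    case 0
    then show ?thesis using 3 rs by auto
  next
    case (Suc j')
    then have "(y # zs) ! Suc j' \<in> set (map hd rs)"
      using 3 rs by (auto simp: Let_def)
    then show ?thesis using Suc rs by (auto simp: Let_def)
  qed
qed auto

text \<open>
  The upper end of an ascent starts a new decreasing run. For a fireworks sequence the heads of the
  runs increase, and each head bounds its run.
\<close>

lemma ascent_top_is_record:
  assumes "sorted_wrt (<) (map hd (dec_runs xs))" "Suc j < length xs" "xs ! j \<le> xs ! Suc j" "b \<le> j"
  shows "xs ! b < xs ! Suc j"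
  using assms
proof (induction xs arbitrary: j b rule: dec_runs.induct)
  case (3 x y zs)
  obtain r rs where rs: "dec_runs (y # zs) = r # rs" "hd r = y"
    using dec_runs_Cons[of y zs] by (cases "dec_runs (y # zs)") auto
  have x: "x < h" if "h \<in> set (map hd (tl (dec_runs (x # y # zs))))" for h
    using 3(2) dec_runs_Cons[of x "y # zs"] that by (cases "dec_runs (x # y # zs)") auto
  have "sorted_wrt (<) (map hd (dec_runs (y # zs)))"
  proof (cases "y < x")
    case True
    then have "\<forall>h\<in>set (map hd rs). y < h" "sorted_wrt (<) (map hd rs)"
      using x 3(2) rs by (fastforce simp: Let_def)+
    then show ?thesis using rs by simp
  next
    case False
    then show ?thesis using 3(2) by (simp add: Let_def)
  qed
  then show ?case
    using 3 x ascent_top_is_head[of j "x # y # zs"] by (cases b; cases j) auto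
qed auto

text \<open>
  The heads of the decreasing runs are the first entry and the upper ends of the weak ascents, so
  replacing them by \<open>0\<close> can be described entrywise.
\<close>

lemma erase_heads:
  assumes "xs \<noteq> []"
  shows "length (concat (map (\<lambda>r. 0 # tl r) (dec_runs xs))) = length xs \<and>
    (\<forall>j<length xs. concat (map (\<lambda>r. 0 # tl r) (dec_runs xs)) ! j =
      (if 0 < j \<and> xs ! j < xs ! (j - 1) then xs ! j else 0))"
  using assms
proof (induction xs rule: dec_runs.induct)
  case (3 x y zs)
  obtain r rs where rs: "dec_runs (y # zs) = (y # r) # rs"
    using dec_runs_Cons[of y zs] by (metis list.collapse)
  have e: "concat (map (\<lambda>r. 0 # tl r) (dec_runs (x # y # zs))) =
      0 # (if y < x then y else 0) # tl (concat (map (\<lambda>r. 0 # tl r) (dec_runs (y # zs))))"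
    using rs by (auto simp: Let_def)
  then show ?case
    using 3 rs by (auto simp: nth_Cons Let_def split: nat.splits)
qed auto

section \<open>From pipe dreams to bumpless vertical-less pipe dreams\<close>

definition erase :: "nat set \<Rightarrow> nat \<Rightarrow> nat" where
  "erase R x = (if x \<in> R then 0 else x)"

lemma pd_front_pos:
  assumes "d < n" "a \<le> d"
  shows "pd_front n D d k a \<in> {n - d..n}"
  using pd_front_bij[OF assms(1), of D k] assms(2) by (auto simp: bij_betw_def)

lemma pd_front_outside: "d < n \<Longrightarrow> d < a \<Longrightarrow> pd_front n D d k a = 0"
  using pd_front_bij[of d n D k] by simp

lemma pd_front_ahead:
  assumes "d < n" "k < a"
  shows "pd_front n D d k a = pd_front n D d 0 a"
  using assms(2) by (induction k) (auto simp: pd_front_cell[OF assms(1)] Let_def)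

lemma pd_front_passed:
  assumes "d < n" "k \<le> l" "a < k"
  shows "pd_front n D d l a = pd_front n D d k a"
  using assms(2) by (induction l rule: dec_induct) (use assms(3) in \<open>auto simp: pd_front_cell[OF assms(1)] Let_def\<close>)

text \<open>
  Erase the record pipes from a pipe dream and delete its first column: cell \<open>(i, j)\<close> of the shadow shows
  what remains in cell \<open>(i, j + 1)\<close>, whose left and bottom labels are at positions \<open>j\<close> and \<open>Suc j\<close> of
  the front. A cross with a record below becomes an H-tile, and one with a record on the left becomes an
  R-tile, because there the larger record turns up.
\<close>

definition shadow :: "nat \<Rightarrow> nat set \<Rightarrow> (nat \<times> nat) set \<Rightarrow> nat \<Rightarrow> nat \<Rightarrow> tile" where
  "shadow n R D i j =
     (if i \<in> {1..n} \<and> j \<in> {1..n - 1} then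
        let h = erase R (pd_front n D (n - i) j j); q = erase R (pd_front n D (n - i) j (Suc j)) in
        if h \<noteq> 0 then (if q \<noteq> 0 then CrossT else if (i, Suc j) \<in> D then HT else JT)
        else if q \<noteq> 0 then RT else BlankT
      else BlankT)"

context
  fixes n :: nat and v :: "nat \<Rightarrow> nat" and D :: "(nat \<times> nat) set" and R :: "nat set"
  assumes n: "n \<ge> 1" and D: "realizes n D v" and good: "bad_bumps n v D = {}"
  defines "R \<equiv> records n v"
begin

text \<open>
  Behind a cross comes the smaller pipe, not a record; behind a bump comes its bottom pipe, a record since
  no bump is bad; behind other tiles there is no pipe. So the crosses can be read off from the vertical
  edges that survive the erasure.
\<close>

lemma cross_iff_right_not_record:
  assumes "d < n"
  shows "(n - d, Suc k) \<in> D \<longleftrightarrow> erase R (pd_front n D d (Suc k) (Suc k)) \<noteq> 0"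
proof (cases "k < d")
  case True
  let ?F = "pd_front n D d k"
  have tri: "(n - d, Suc k) \<in> triangle n"
    using True assms by (auto simp: triangle_def)
  have right: "pd_front n D d (Suc k) (Suc k) =
      (if (n - d, Suc k) \<in> D then min (?F k) (?F (Suc k)) else ?F (Suc k))"
    using True assms by (auto simp: pd_front_cell Let_def)
  show ?thesis
  proof (cases "(n - d, Suc k) \<in> D")
    case in_D: True
    moreover have "min (?F k) (?F (Suc k)) > 0"
      using pd_front_pos[OF assms, of k D k] pd_front_pos[OF assms, of "Suc k" D k] True assms by auto
    ultimately show ?thesis
      using min_at_cross_not_record[OF D assms True in_D] right by (simp add: erase_def R_def)
  next
    case False
    have "(n - d, Suc k) \<notin> bad_bumps n v D" using good by simp
    then have "?F (Suc k) \<in> R"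
      using False tri assms by (simp add: bad_bumps_def R_def)
    then show ?thesis
      using right False by (simp add: erase_def)
  qed
next
  case False
  then have "(n - d, Suc k) \<notin> D"
    using D assms by (auto simp: realizes_def triangle_def)
  then show ?thesis
    using pd_front_outside[OF assms, of "Suc k" D "Suc k"] False by (simp add: erase_def)
qed

text \<open>
  Locally the shadow has its strands where the surviving labels are, and moves them as the pipe dream
  does. Vertical strands do not arise: at a cross the right label is not a record, hence survives, and at
  a bump the bottom label is erased.
\<close>

lemma shadow_cell:
  assumes d: "d < n" and j: "1 \<le> j" "j \<le> n - 1"
  defines "G \<equiv> \<lambda>a. erase R (pd_front n D d j a)" and "G' \<equiv> \<lambda>a. erase R (pd_front n D d (Suc j) a)"
    and "t \<equiv> shadow n R D (n - d) j"
  shows "LeftE \<in> edges t \<longleftrightarrow> G j \<noteq> 0" "BottomE \<in> edges t \<longleftrightarrow> G (Suc j) \<noteq> 0"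
    "TopE \<in> edges t \<longleftrightarrow> G' j \<noteq> 0" "RightE \<in> edges t \<longleftrightarrow> G' (Suc j) \<noteq> 0"
    "(\<lambda>a. G' (Suc a)) = cell_op t (j - 1) (\<lambda>a. G (Suc a))"
proof -
  let ?F = "pd_front n D d j" and ?F' = "pd_front n D d (Suc j)"
  have t: "t = (if G j \<noteq> 0 then (if G (Suc j) \<noteq> 0 then CrossT else if (n - d, Suc j) \<in> D then HT else JT)
      else if G (Suc j) \<noteq> 0 then RT else BlankT)"
    using d j by (auto simp: t_def shadow_def G_def Let_def)
  show "LeftE \<in> edges t \<longleftrightarrow> G j \<noteq> 0" "BottomE \<in> edges t \<longleftrightarrow> G (Suc j) \<noteq> 0"
    unfolding t by auto
  have F': "?F' = (if j < d \<and> (n - d, Suc j) \<in> D \<and> ?F j < ?F (Suc j)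
      then ?F(j := ?F (Suc j), Suc j := ?F j) else ?F)"
    using d by (simp add: pd_front_cell Let_def)
  have D_le: "(n - d, Suc j) \<in> D \<Longrightarrow> j < d"
    using D d by (auto simp: realizes_def triangle_def)
  have right: "(n - d, Suc j) \<in> D \<longleftrightarrow> G' (Suc j) \<noteq> 0"
    using cross_iff_right_not_record[OF d] by (simp add: G'_def)
  have neq: "(n - d, Suc j) \<in> D \<Longrightarrow> ?F j \<noteq> ?F (Suc j)"
    using pd_front_neq[OF d D_le] by simp
  have e: "erase R x \<noteq> 0 \<Longrightarrow> erase R x = x" for x
    by (auto simp: erase_def)
  have "(TopE \<in> edges t \<longleftrightarrow> G' j \<noteq> 0) \<and> (RightE \<in> edges t \<longleftrightarrow> G' (Suc j) \<noteq> 0) \<and>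
    (\<forall>a. G' (Suc a) = cell_op t (j - 1) (\<lambda>a. G (Suc a)) a)"
  proof (cases "(n - d, Suc j) \<in> D")
    case True
    show ?thesis
    proof (cases "?F j < ?F (Suc j)")
      case lt: True
      then have sw: "?F' = ?F(j := ?F (Suc j), Suc j := ?F j)"
        using F' True D_le by simp
      then have G': "G' j = G (Suc j)" "G' (Suc j) = G j" "\<And>a. a \<noteq> j \<Longrightarrow> a \<noteq> Suc j \<Longrightarrow> G' a = G a"
        by (simp_all add: G_def G'_def)
      have "G j \<noteq> 0" using right True G' by simp
      then show ?thesis
        using G' t True j lt e[of "?F j"] e[of "?F (Suc j)"] by (auto simp: cell_op_def G_def)
    next
      case False
      then have sw: "G' = G"
        using F' by (simp add: G_def G'_def)
      have "G (Suc j) \<noteq> 0" using right True sw by simp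
      then show ?thesis
        using sw t True j False e[of "?F j"] e[of "?F (Suc j)"] by (auto simp: cell_op_def G_def)
    qed
  next
    case False
    then have sw: "G' = G"
      using F' by (simp add: G_def G'_def)
    have "G (Suc j) = 0" using right False sw by simp
    then show ?thesis
      using sw t False j by (auto simp: cell_op_def)
  qed
  then show "TopE \<in> edges t \<longleftrightarrow> G' j \<noteq> 0" "RightE \<in> edges t \<longleftrightarrow> G' (Suc j) \<noteq> 0"
    "(\<lambda>a. G' (Suc a)) = cell_op t (j - 1) (\<lambda>a. G (Suc a))"
    by auto
qed

lemma left_edge_shadow:
  assumes "1 \<le> i" "i \<le> n" "1 \<le> j" "j \<le> n - 1"
  shows "LeftE \<in> edges (shadow n R D i j) \<longleftrightarrow> (i, j) \<in> D"
  using shadow_cell(1)[of "n - i" j] cross_iff_right_not_record[of "n - i" "j - 1"] assms by simp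

lemma bvpd_shadow: "bvpd n (shadow n R D)"
proof -
  let ?B = "shadow n R D"
  have out: "\<not> (i \<in> {1..n} \<and> j \<in> {1..n - 1}) \<Longrightarrow> ?B i j = BlankT" for i j
    by (auto simp: shadow_def)
  have ran: "?B i j \<in> {BlankT, HT, CrossT, JT, RT}" for i j
    by (simp add: shadow_def Let_def)
  have hor: "RightE \<in> edges (?B i j) \<longleftrightarrow> LeftE \<in> edges (?B i (j + 1))"
    if "1 \<le> i" "i \<le> n" "1 \<le> j" "j < n - 1" for i j
    using shadow_cell(4)[of "n - i" j] shadow_cell(1)[of "n - i" "Suc j"] that by simp
  have ver: "BottomE \<in> edges (?B i j) \<longleftrightarrow> TopE \<in> edges (?B (i + 1) j)"
    if "1 \<le> i" "i < n" "1 \<le> j" "j \<le> n - 1" for i j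
  proof -
    define d where "d = n - Suc i"
    have d: "n - i = Suc d" "Suc d < n" "n - d = Suc i" "n - Suc d = i"
      using that by (auto simp: d_def)
    have "pd_front n D (Suc d) j (Suc j) = pd_front n D d n j"
      using pd_front_ahead[of "Suc d" n j "Suc j" D] d(2) by (simp add: pd_front_row)
    also have "\<dots> = pd_front n D d (Suc j) j"
      using pd_front_passed[of d n "Suc j" n j D] d that by simp
    finally show ?thesis
      using shadow_cell(2)[of "Suc d" j] shadow_cell(3)[of d j] d that by simp
  qed
  have last: "RightE \<notin> edges (?B i (n - 1))" if "1 \<le> i" "i \<le> n" for i
  proof (cases "n = 1")
    case False
    have "pd_front n D (n - i) n n = 0"
      using pd_front_outside[of "n - i" n n D n] that by simp
    then show ?thesis
      using shadow_cell(4)[of "n - i" "n - 1"] False n that by (simp add: erase_def)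
  qed (simp add: shadow_def)
  have bottom: "BottomE \<notin> edges (?B n j)" if "1 \<le> j" "j \<le> n - 1" for j
    using shadow_cell(2)[of 0 j] pd_front_outside[of 0 n "Suc j" D j] that n by (simp add: erase_def)
  show ?thesis
    unfolding bvpd_def tiling_def using out ran hor ver last bottom by auto
qed

lemma wty_shadow: "wty_BVPD n (shadow n R D) = D"
proof -
  have "shadow n R D i j \<in> {CrossT, JT, HT} \<longleftrightarrow> LeftE \<in> edges (shadow n R D i j)" for i j
    by (simp add: shadow_def Let_def)
  moreover have "D \<subseteq> {(i, j). i \<in> {1..n} \<and> j \<in> {1..n - 1}}"
    using D by (auto simp: realizes_def triangle_def)
  ultimately show ?thesis
    using left_edge_shadow unfolding wty_BVPD_def cells_with_def by auto
qed

lemma entry_shadow: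
  assumes "d < n"
  shows "entry (shadow n R D) (n - d) = erase R (pd_front n D d 1 1)"
proof -
  have left: "LeftE \<in> edges (shadow n R D (n - d) 1) \<longleftrightarrow> (n - d, 1) \<in> D"
  proof (cases "n = 1")
    case True
    then show ?thesis using D by (auto simp: shadow_def realizes_def triangle_def)
  qed (use left_edge_shadow[of "n - d" 1] assms n in simp)
  have iff: "(n - d, 1) \<in> D \<longleftrightarrow> erase R (pd_front n D d 1 1) \<noteq> 0"
    using cross_iff_right_not_record[OF assms, of 0] by simp
  have "pd_front n D d 1 1 = n - d" if in_D: "(n - d, 1) \<in> D"
  proof -
    have "0 < d" using in_D D assms by (auto simp: realizes_def triangle_def)
    then obtain d' where d': "d = Suc d'" by (cases d) auto
    have "n - d < pd_front n D d' n 0"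
      using pd_front_pos[of d' n 0 D n] assms d' by auto
    then show ?thesis
      using in_D assms d' pd_front_cell[OF assms, of D 0] by (simp add: pd_front_row)
  qed
  then show ?thesis
    using left iff assms by (auto simp: entry_def erase_def)
qed

lemma front_shadow:
  assumes "d < n" "k \<le> n - 1"
  shows "front n (n - 1) (shadow n R D) d k = (\<lambda>a. erase R (pd_front n D d (Suc k) (Suc a)))"
proof -
  have step: "front n (n - 1) (shadow n R D) d k = (\<lambda>a. erase R (pd_front n D d (Suc k) (Suc a)))"
    if "d < n" "k \<le> n - 1"
      "front n (n - 1) (shadow n R D) d 0 = (\<lambda>a. erase R (pd_front n D d 1 (Suc a)))" for d k
    using that
  proof (induction k)
    case (Suc k)
    then show ?case
      using shadow_cell(5)[of d "Suc k"] by (simp add: front.simps(3))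
  qed simp
  have ahead: "pd_front n D d 1 (Suc (Suc a)) = pd_front n D d 0 (Suc (Suc a))" if "d < n" for d a
    using pd_front_ahead[OF that, of 1 "Suc (Suc a)"] by simp
  have "front n (n - 1) (shadow n R D) d 0 = (\<lambda>a. erase R (pd_front n D d 1 (Suc a)))"
    using assms(1)
  proof (induction d)
    case 0
    show ?case
      using entry_shadow[OF 0] ahead[OF 0] n
      by (auto simp: front.simps pd_front_first erase_def split: nat.split)
  next
    case (Suc d)
    have "front n (n - 1) (shadow n R D) d (n - 1) = (\<lambda>a. erase R (pd_front n D d n (Suc a)))"
      using step[of d "n - 1"] Suc n by simp
    then show ?case
      using entry_shadow[OF Suc.prems] ahead[OF Suc.prems] Suc.prems
      by (auto simp: front.simps(2) pd_front_row split: nat.split)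
  qed
  then show ?thesis using step assms by blast
qed

lemma exit_pipe_shadow:
  assumes "c \<in> {1..<n}"
  shows "exit_pipe n (n - 1) (shadow n R D) c = erase R (v c)"
proof -
  have "exit_pipe n (n - 1) (shadow n R D) c = front n (n - 1) (shadow n R D) (n - 1) (n - 1) (c - 1)"
    by (rule exit_pipe_front) (use bvpd_shadow assms in \<open>auto simp: bvpd_def\<close>)
  also have "\<dots> = erase R (pd_front n D (n - 1) n c)"
    using front_shadow[of "n - 1" "n - 1"] assms by simp
  finally show ?thesis
    using D assms by (simp add: realizes_def)
qed

end

section \<open>Labels of fronts and left-to-right maxima\<close>

lemma range_cell_op: "range (cell_op t k F) = range F"
proof -
  have "cell_op t k F = F \<or> cell_op t k F = F \<circ> transpose k (Suc k)"
    by (auto simp: cell_op_def transpose_def)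
  then show ?thesis
    by (metis image_comp surj_transpose)
qed

lemma range_case_nat: "range (case_nat e F) = insert e (range F)"
proof -
  have "case_nat e F a \<in> insert e (range F)" for a
    by (cases a) auto
  moreover have "e \<in> range (case_nat e F)" "F a \<in> range (case_nat e F)" for a
    using rangeI[of "case_nat e F" 0] rangeI[of "case_nat e F" "Suc a"] by simp_all
  ultimately show ?thesis by blast
qed

text \<open>
  No pipe gets lost: the labels on a front are the pipes that have entered so far.
\<close>

lemma range_front:
  assumes "d < n"
  shows "insert 0 (range (front n m T d k)) =
    insert 0 {i \<in> {n - d..n}. LeftE \<in> edges (T i 1)}"
  using assms
proof (induction n m T d k rule: front.induct)
  case (1 n m T)
  then show ?case by (auto simp: front.simps range_case_nat entry_def)
next
  case (2 n m T d)
  let ?E = "\<lambda>d. {i \<in> {n - d..n}. LeftE \<in> edges (T i 1)}"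
  have "{n - Suc d..n} = insert (n - Suc d) {n - d..n}"
    using 2 by auto
  then have E: "insert 0 (?E (Suc d)) = insert (entry T (n - Suc d)) (insert 0 (?E d))"
    by (auto simp: entry_def)
  have "insert 0 (range (front n m T (Suc d) 0)) =
      insert (entry T (n - Suc d)) (insert 0 (range (front n m T d m)))"
    by (simp add: front.simps(2) range_case_nat insert_commute)
  also have "\<dots> = insert (entry T (n - Suc d)) (insert 0 (?E d))"
    using 2 by simp
  finally show ?case
    using E by simp
qed (simp add: front.simps range_cell_op)

lemma record_increasing:
  assumes "inj_on v {..<n}" "b < n" "v b \<in> records n v" "a < b"
  shows "v a < v b"
proof -
  obtain c where "c < n" "v c = v b" "\<forall>a<c. v a < v c"
    using assms(3) by (auto simp: records_def)
  moreover from this have "c = b"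
    using assms by (auto simp: inj_on_def)
  ultimately show ?thesis using assms(4) by auto
qed

lemma max_mem_records:
  assumes "bij_betw v {..<n} {1..n}" "n \<ge> 1"
  shows "n \<in> records n v"
proof -
  have "n \<in> v ` {..<n}"
    using assms by (simp add: bij_betw_def)
  then obtain c where c: "c < n" "v c = n"
    by auto
  have "v b < n" if "b < c" for b
  proof -
    have "v b \<in> {1..n}" "v b \<noteq> v c"
      using that c assms(1) by (auto simp: bij_betw_def inj_on_def)
    then show ?thesis using c by simp
  qed
  then show ?thesis
    using c by (auto simp: records_def)
qed

text \<open>
  The positions of the elements of \<open>R\<close> and their set are known, and these elements increase from left
  to right. At the first disagreement the smaller of the two values would have to occur in the other
  sequence even earlier.
\<close>

lemma determined_by_nonrecords:
  fixes f g :: "nat \<Rightarrow> nat"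
  assumes f: "bij_betw f {..<n} S" and g: "bij_betw g {..<n} S" and "0 \<notin> S"
    and erase: "\<And>a. a < n \<Longrightarrow> erase R (f a) = erase R (g a)"
    and incr: "\<And>a b. a < b \<Longrightarrow> b < n \<Longrightarrow> f b \<in> R \<Longrightarrow> f a < f b"
      "\<And>a b. a < b \<Longrightarrow> b < n \<Longrightarrow> g b \<in> R \<Longrightarrow> g a < g b"
  shows "a < n \<Longrightarrow> f a = g a"
proof (induction a rule: less_induct)
  case (less a)
  have nz: "f a \<noteq> 0 \<and> g a \<noteq> 0" if "a < n" for a
    using bij_betw_apply[OF f, of a] bij_betw_apply[OF g, of a] that \<open>0 \<notin> S\<close> by (metis lessThan_iff)
  have iff: "f a \<in> R \<longleftrightarrow> g a \<in> R" if "a < n" for a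
    using erase[OF that] nz[OF that] by (auto simp: erase_def split: if_splits)
  show ?case
  proof (rule ccontr)
    assume ne: "f a \<noteq> g a"
    then have R: "f a \<in> R" "g a \<in> R"
      using erase[OF less.prems] iff[OF less.prems] by (auto simp: erase_def split: if_splits)
    have *: False if h: "bij_betw h {..<n} S" "bij_betw k {..<n} S" "h a < k a" "h a \<in> R"
        "\<And>a b. a < b \<Longrightarrow> b < n \<Longrightarrow> k b \<in> R \<Longrightarrow> k a < k b" "\<And>b. b < a \<Longrightarrow> h b = k b"
        "k a \<in> R" for h k :: "nat \<Rightarrow> nat"
    proof -
      have "h a \<in> S" using h(1) less.prems by (auto simp: bij_betw_def)
      then have "h a \<in> k ` {..<n}" using h(2) by (simp add: bij_betw_def)
      then obtain b where b: "b < n" "k b = h a" by auto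
      have "b < a"
        using h(5)[of a b] b h(3,4) less.prems by (cases a b rule: linorder_cases) auto
      then have "h b = h a" using h(6) b by simp
      then show False
        using h(1) \<open>b < a\<close> b less.prems by (auto simp: bij_betw_def inj_on_def)
    qed
    have IH: "\<And>b. b < a \<Longrightarrow> f b = g b"
      using less by simp
    show False
    proof (cases "f a < g a")
      case True
      then show False using *[OF f g _ R(1) incr(2) IH R(2)] by blast
    next
      case False
      then have "g a < f a" using ne by simp
      then show False using *[OF g f _ R(2) incr(1) IH[symmetric] R(1)] by blast
    qed
  qed
qed

text \<open>
  The invariant from which the erased labels can be reconstructed. The bound \<open>d\<close> cuts off the
  positions without pipe.
\<close>

definition records_are :: "nat set \<Rightarrow> nat \<Rightarrow> (nat \<Rightarrow> nat) \<Rightarrow> bool" where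
  "records_are R d F \<longleftrightarrow> (\<forall>a\<le>d. F a \<in> R \<longleftrightarrow> (\<forall>b<a. F b < F a))"

lemma records_are_swap:
  assumes "records_are R d F" "F s < F (Suc s)" "F s \<notin> R" "s < d"
  shows "records_are R d (F(s := F (Suc s), Suc s := F s))"
  unfolding records_are_def
proof (intro allI impI)
  fix a assume "a \<le> d"
  let ?F' = "F(s := F (Suc s), Suc s := F s)"
  have F: "F a \<in> R \<longleftrightarrow> (\<forall>b<a. F b < F a)" if "a \<le> d" for a
    using assms(1) that by (simp add: records_are_def)
  consider "a < s" | "a = s" | "a = Suc s" | "Suc s < a" by linarith
  then show "?F' a \<in> R \<longleftrightarrow> (\<forall>b<a. ?F' b < ?F' a)"
  proof cases
    case 1
    then show ?thesis using F[OF \<open>a \<le> d\<close>] by auto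
  next
    case 2
    have "?F' a \<in> R \<longleftrightarrow> (\<forall>b<Suc s. F b < F (Suc s))"
      using 2 F[of "Suc s"] assms(4) by simp
    also have "\<dots> \<longleftrightarrow> (\<forall>b<s. F b < F (Suc s))"
      using assms(2) by (auto simp: less_Suc_eq)
    finally show ?thesis using 2 by auto
  next
    case 3
    then show ?thesis using assms(2,3) by auto
  next
    case 4
    have "(\<forall>b<a. ?F' b < F a) \<longleftrightarrow> (\<forall>b<a. F b < F a)"
    proof
      assume L: "\<forall>b<a. ?F' b < F a"
      show "\<forall>b<a. F b < F a"
      proof (intro allI impI)
        fix b assume "b < a"
        then show "F b < F a"
          using L[rule_format, of b] L[rule_format, of s] L[rule_format, of "Suc s"] 4
          by (auto split: if_splits)
      qed
    qed (use 4 in auto)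
    then show ?thesis using F[OF \<open>a \<le> d\<close>] 4 by simp
  qed
qed

section \<open>Left edges in bumpless vertical-less pipe dreams\<close>

text \<open>
  The rightmost cell with a left edge in a row is a J-tile, whose strand goes up into a tile which must
  turn it to the right, because there are no vertical tiles. So the rightmost left edge lies at
  least one column further to the right in the row above.
\<close>

lemma bvpd_left_edge_triangle:
  assumes B: "bvpd n B" and "1 \<le> i" "i \<le> n" "1 \<le> j" "j \<le> n - 1" "LeftE \<in> edges (B i j)"
  shows "i + j \<le> n"
  using assms(2-)
proof (induction i arbitrary: j rule: dec_induct)
  case base
  then show ?case by linarith
next
  case (step i)
  have til: "tiling n (n - 1) B" and ran: "B (Suc i) j \<in> {BlankT, HT, CrossT, JT, RT}"
      "B i j \<in> {BlankT, HT, CrossT, JT, RT}" if "1 \<le> j" "j \<le> n - 1" for j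
    using B step that by (auto simp: bvpd_def)
  let ?S = "{j \<in> {1..n - 1}. LeftE \<in> edges (B (Suc i) j)}"
  define l where "l = Max ?S"
  have "j \<in> ?S" using step.prems by simp
  then have l: "l \<in> ?S" "j \<le> l"
    unfolding l_def by (intro Max_in Max_ge; auto)+
  have "RightE \<notin> edges (B (Suc i) l)"
  proof (cases "l < n - 1")
    case True
    have "Suc l \<notin> ?S"
    proof
      assume "Suc l \<in> ?S"
      then have "Suc l \<le> l"
        unfolding l_def by (intro Max_ge) auto
      then show False by simp
    qed
    then show ?thesis
      using tilingD(2)[OF til, of l "Suc i" l] step True l(1) by auto
  next
    case False
    then have "l = n - 1" using l(1) by auto
    then show ?thesis using tilingD(4)[OF til, of l "Suc i"] step l(1) by auto
  qed
  then have "TopE \<in> edges (B (Suc i) l)"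
    using l(1) ran(1)[of l] by auto
  then have "BottomE \<in> edges (B i l)"
    using tilingD(3)[OF til, of l i l] l(1) step by auto
  then have R: "RightE \<in> edges (B i l)"
    using ran(2)[of l] l(1) by auto
  then have "l < n - 1"
    using tilingD(4)[OF til, of l i] l(1) step by (cases "l = n - 1") auto
  then have "LeftE \<in> edges (B i (Suc l))"
    using tilingD(2)[OF til, of l i l] R l(1) step by auto
  then show ?case
    using step.IH[of "Suc l"] \<open>l < n - 1\<close> l step.prems by auto
qed

lemma left_edge_bvpd:
  assumes "bvpd n B" "1 \<le> i" "i \<le> n" "1 \<le> j" "j \<le> n - 1"
  shows "LeftE \<in> edges (B i j) \<longleftrightarrow> (i, j) \<in> wty_BVPD n B"
proof -
  have "B i j \<in> {BlankT, HT, CrossT, JT, RT}"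
    using assms by (simp add: bvpd_def)
  then show ?thesis
    using assms by (auto simp: wty_BVPD_def cells_with_def)
qed

lemma wty_bvpd_subset_triangle:
  assumes "bvpd n B"
  shows "wty_BVPD n B \<subseteq> triangle n"
proof
  fix c assume c: "c \<in> wty_BVPD n B"
  obtain i j where ij: "c = (i, j)" "i \<in> {1..n}" "j \<in> {1..n - 1}"
    using c by (auto simp: wty_BVPD_def cells_with_def)
  then show "c \<in> triangle n"
    using c left_edge_bvpd[OF assms, of i j] bvpd_left_edge_triangle[OF assms, of i j]
    by (auto simp: triangle_def)
qed

text \<open>
  A tile of a bumpless vertical-less pipe dream is determined by its left, right and bottom edges. Left
  edges determine right edges within a row, and bottom edges are known from the row below.
\<close>

lemma bvpd_eqI:
  assumes B: "bvpd n B" and B': "bvpd n B'" and eq: "wty_BVPD n B = wty_BVPD n B'"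
  shows "B = B'"
proof -
  have til: "tiling n (n - 1) B" "tiling n (n - 1) B'"
    using B B' by (auto simp: bvpd_def)
  have left: "LeftE \<in> edges (B i j) \<longleftrightarrow> LeftE \<in> edges (B' i j)"
    if "1 \<le> i" "i \<le> n" "1 \<le> j" "j \<le> n - 1" for i j
    using left_edge_bvpd[OF B that] left_edge_bvpd[OF B' that] eq by simp
  have right: "RightE \<in> edges (B i j) \<longleftrightarrow> RightE \<in> edges (B' i j)"
    if "1 \<le> i" "i \<le> n" "1 \<le> j" "j \<le> n - 1" for i j
  proof (cases "j = n - 1")
    case True
    then show ?thesis using tilingD(4)[OF til(1), of i] tilingD(4)[OF til(2), of i] that by simp
  next
    case False
    then show ?thesis
      using tilingD(2)[OF til(1), of i j] tilingD(2)[OF til(2), of i j] left[of i "Suc j"] that by simp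
  qed
  have tile: "t = t'" if "t \<in> {BlankT, HT, CrossT, JT, RT}" "t' \<in> {BlankT, HT, CrossT, JT, RT}"
    "LeftE \<in> edges t \<longleftrightarrow> LeftE \<in> edges t'" "RightE \<in> edges t \<longleftrightarrow> RightE \<in> edges t'"
    "BottomE \<in> edges t \<longleftrightarrow> BottomE \<in> edges t'" for t t'
    using that by auto
  have row: "\<forall>j. 1 \<le> j \<longrightarrow> j \<le> n - 1 \<longrightarrow> B (n - d) j = B' (n - d) j" if "d < n" for d
    using that
  proof (induction d)
    case 0
    have "B n j = B' n j" if "1 \<le> j" "j \<le> n - 1" for j
      by (rule tile) (use B B' 0 that left right tilingD(5)[OF til(1)] tilingD(5)[OF til(2)] in
          \<open>auto simp: bvpd_def\<close>)
    then show ?case by simp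
  next
    case (Suc d)
    have i: "1 \<le> n - Suc d" "n - Suc d < n" "Suc (n - Suc d) = n - d"
      using Suc.prems by auto
    have "B (n - Suc d) j = B' (n - Suc d) j" if j: "1 \<le> j" "j \<le> n - 1" for j
    proof (rule tile)
      show "BottomE \<in> edges (B (n - Suc d) j) \<longleftrightarrow> BottomE \<in> edges (B' (n - Suc d) j)"
        using tilingD(3)[OF til(1) i(1,2) j] tilingD(3)[OF til(2) i(1,2) j] Suc j i(3) by simp
    qed (use B B' i j left[of "n - Suc d" j] right[of "n - Suc d" j] in \<open>auto simp: bvpd_def\<close>)
    then show ?case by simp
  qed
  have "B i j = B' i j" for i j
  proof (cases "i \<in> {1..n} \<and> j \<in> {1..n - 1}")
    case True
    then show ?thesis using row[of "n - i"] by auto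
  next
    case False
    then show ?thesis using tilingD(1)[OF til(1) False] tilingD(1)[OF til(2) False] by simp
  qed
  then show ?thesis by (simp add: fun_eq_iff)
qed

section \<open>From bumpless vertical-less pipe dreams to pipe dreams\<close>

text \<open>
  The converse construction: the cells with a left edge in a bumpless vertical-less pipe dream \<open>B\<close> are taken
  as the crosses of a pipe dream. Tracing both at once shows that \<open>B\<close> is the shadow of that pipe dream.
\<close>

context
  fixes n :: nat and v :: "nat \<Rightarrow> nat" and B :: "nat \<Rightarrow> nat \<Rightarrow> tile"
    and R :: "nat set" and D :: "(nat \<times> nat) set"
  assumes n: "n \<ge> 1" and v: "bij_betw v {..<n} {1..n}" and B: "bvpd n B"
    and exits: "\<And>c. c \<in> {1..<n} \<Longrightarrow> exit_pipe n (n - 1) B c = erase (records n v) (v c)"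
  defines "R \<equiv> records n v" and "D \<equiv> wty_BVPD n B"
begin

lemma tiling_bvpd: "tiling n (n - 1) B"
  using B by (simp add: bvpd_def)

lemma final_front_bvpd:
  "front n (n - 1) B (n - 1) (n - 1) a = (if a < n - 1 then erase R (v (Suc a)) else 0)"
proof (cases "a < n - 1")
  case True
  then show ?thesis
    using exits[of "Suc a"] exit_pipe_front[OF tiling_bvpd n, of "Suc a"] by (simp add: R_def)
next
  case False
  then show ?thesis
    using front_edges[OF tiling_bvpd, of "n - 1" "n - 1"] n by (cases "a = n - 1") auto
qed

lemma first_mem_records: "v 0 \<in> R"
  using n by (auto simp: R_def records_def intro!: exI[of _ 0])

text \<open>
  The pipes that enter \<open>B\<close> are the pipes that leave it, and these are the nonzero entries of its
  code.
\<close>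

lemma enters_iff_not_record:
  assumes "1 \<le> i" "i \<le> n"
  shows "LeftE \<in> edges (B i 1) \<longleftrightarrow> i \<notin> R"
proof -
  let ?F = "front n (n - 1) B (n - 1) (n - 1)"
  have "insert 0 (range ?F) = insert 0 {i \<in> {n - (n - 1)..n}. LeftE \<in> edges (B i 1)}"
    using range_front[of "n - 1" n "n - 1" B "n - 1"] n by simp
  moreover have "n - (n - 1) = 1"
    using n by simp
  ultimately have "i \<in> insert 0 (range ?F) \<longleftrightarrow> i \<in> insert 0 {i \<in> {1..n}. LeftE \<in> edges (B i 1)}"
    by simp
  then have "LeftE \<in> edges (B i 1) \<longleftrightarrow> i \<in> range ?F"
    using assms by simp
  also have "\<dots> \<longleftrightarrow> i \<notin> R"
  proof
    assume "i \<in> range ?F"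
    then obtain a where "i = ?F a" by blast
    then have "i = (if a < n - 1 then erase R (v (Suc a)) else 0)"
      using final_front_bvpd[of a] by simp
    then show "i \<notin> R" using assms by (auto simp: erase_def split: if_splits)
  next
    assume i: "i \<notin> R"
    have "i \<in> v ` {..<n}" using v assms by (simp add: bij_betw_def)
    then obtain c where c: "c < n" "v c = i" by auto
    then have "c \<noteq> 0" using i first_mem_records by metis
    then have "c - 1 < n - 1" using c by simp
    then have "?F (c - 1) = i"
      using final_front_bvpd[of "c - 1"] c i \<open>c \<noteq> 0\<close> by (simp add: erase_def)
    then show "i \<in> range ?F" by (metis rangeI)
  qed
  finally show ?thesis .
qed

lemma entry_bvpd: "1 \<le> i \<Longrightarrow> i \<le> n \<Longrightarrow> entry B i = erase R i"
  using enters_iff_not_record[of i] by (simp add: entry_def erase_def)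

lemma first_cross_iff:
  assumes "1 \<le> i" "i \<le> n"
  shows "(i, 1) \<in> D \<longleftrightarrow> i \<notin> R"
proof (cases "n = 1")
  case True
  then have "i \<in> R"
    using max_mem_records[OF v n] assms by (simp add: R_def)
  then show ?thesis using True by (simp add: D_def wty_BVPD_def cells_with_def)
next
  case False
  then show ?thesis
    using left_edge_bvpd[OF B assms, of 1] enters_iff_not_record[OF assms] n by (simp add: D_def)
qed

lemma D_triangle: "D \<subseteq> triangle n"
  using wty_bvpd_subset_triangle[OF B] by (simp add: D_def)

lemma cross_iff_right_edge:
  assumes "1 \<le> i" "i \<le> n" "1 \<le> j" "j \<le> n - 1"
  shows "(i, Suc j) \<in> D \<longleftrightarrow> RightE \<in> edges (B i j)"
proof (cases "j = n - 1")
  case True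
  then show ?thesis
    using D_triangle tilingD(4)[OF tiling_bvpd, of i] assms by (auto simp: triangle_def)
next
  case False
  then show ?thesis
    using tilingD(2)[OF tiling_bvpd, of i j] left_edge_bvpd[OF B assms(1,2), of "Suc j"] assms
    by (simp add: D_def)
qed

definition simulated :: "nat \<Rightarrow> nat \<Rightarrow> bool" where
  "simulated d k \<longleftrightarrow>
     front n (n - 1) B d k = (\<lambda>a. erase R (pd_front n D d (Suc k) (Suc a))) \<and>
     records_are R d (pd_front n D d (Suc k))"

lemma simulated_first: "simulated 0 0"
proof -
  have "pd_front n D 0 1 = case_nat n (\<lambda>_. 0)"
    using pd_front_cell[of 0 n D 0] pd_front_first[OF n] n by simp
  moreover have "n \<in> R"
    using max_mem_records[OF v n] by (simp add: R_def)
  moreover have "front n (n - 1) B 0 0 = (\<lambda>_. 0)"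
    using entry_bvpd[of n] n \<open>n \<in> R\<close> by (auto simp: front.simps erase_def split: nat.split)
  ultimately show ?thesis
    by (simp add: simulated_def records_are_def erase_def)
qed

text \<open>
  The new pipe is smaller than all others. If it is a record, it takes the first place on a bump.
  Otherwise a cross in column \<open>1\<close> places it right behind the first label, and the latter is a record.
\<close>

lemma simulated_row:
  assumes d: "Suc d < n" and sim: "simulated d (n - 1)"
  shows "simulated (Suc d) 0"
proof -
  let ?i = "n - Suc d" and ?G = "pd_front n D d n"
  let ?F = "pd_front n D (Suc d) 1"
  have G: "front n (n - 1) B d (n - 1) = (\<lambda>a. erase R (?G (Suc a)))" "records_are R d ?G"
    using sim n by (auto simp: simulated_def)
  have big: "?i < ?G a" if "a \<le> d" for a
    using pd_front_pos[of d n a D n] d that by auto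
  have G0: "?G 0 \<in> R"
    using G(2) by (simp add: records_are_def)
  have B0: "front n (n - 1) B (Suc d) 0 = case_nat (erase R ?i) (\<lambda>a. erase R (?G (Suc a)))"
    using entry_bvpd[of ?i] d unfolding front.simps(2) G(1) by simp
  have F: "?F = (if ?i \<in> R then case_nat ?i ?G else (case_nat ?i ?G)(0 := ?G 0, Suc 0 := ?i))"
    using pd_front_cell[OF d, of D 0] first_cross_iff[of ?i] d big[of 0]
    by (simp add: pd_front_row)
  have rec0: "records_are R (Suc d) (case_nat ?i ?G)" if "?i \<in> R"
    unfolding records_are_def
  proof (intro allI impI)
    fix a assume "a \<le> Suc d"
    show "case_nat ?i ?G a \<in> R \<longleftrightarrow> (\<forall>b<a. case_nat ?i ?G b < case_nat ?i ?G a)"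
    proof (cases a)
      case (Suc a')
      then have "(\<forall>b<a. case_nat ?i ?G b < ?G a') \<longleftrightarrow> (\<forall>b<a'. ?G b < ?G a')"
        using big[of a'] \<open>a \<le> Suc d\<close> by (auto simp: less_Suc_eq_0_disj)
      then show ?thesis
        using G(2) Suc \<open>a \<le> Suc d\<close> by (simp add: records_are_def)
    qed (use that in simp)
  qed
  have rec1: "records_are R (Suc d) ((case_nat ?i ?G)(0 := ?G 0, Suc 0 := ?i))" if "?i \<notin> R"
    unfolding records_are_def
  proof (intro allI impI)
    fix a assume "a \<le> Suc d"
    let ?H = "(case_nat ?i ?G)(0 := ?G 0, Suc 0 := ?i)"
    consider "a = 0" | "a = 1" | a' where "a = Suc (Suc a')"
      by (metis One_nat_def not0_implies_Suc)
    then show "?H a \<in> R \<longleftrightarrow> (\<forall>b<a. ?H b < ?H a)"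
    proof cases
      case 1
      then show ?thesis using G0 by simp
    next
      case 2
      then show ?thesis using that big[of 0] by auto
    next
      case 3
      have "(\<forall>b<a. ?H b < ?G (Suc a')) \<longleftrightarrow> (\<forall>b<Suc a'. ?G b < ?G (Suc a'))"
        using big[of "Suc a'"] \<open>a \<le> Suc d\<close> 3 by (auto simp: less_Suc_eq_0_disj)
      then show ?thesis
        using G(2) 3 \<open>a \<le> Suc d\<close> by (simp add: records_are_def)
    qed
  qed
  have "case_nat (erase R ?i) (\<lambda>a. erase R (?G (Suc a))) = (\<lambda>a. erase R (?F (Suc a)))"
    using F G0 by (auto simp: erase_def split: nat.split)
  then show ?thesis
    using B0 F rec0 rec1 by (simp add: simulated_def)
qed

text \<open>
  Two nonrecords meet in a cross of \<open>B\<close> and are sorted in both pictures. At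
  an H-tile a nonrecord meets a record below it, which is larger, so the cross of the pipe dream swaps
  them; at an R-tile the record comes first and dominates, so the cross has no effect. In all other
  cases the pipe dream has no cross.
\<close>

lemma simulated_cell:
  assumes d: "d < n" and k: "Suc k \<le> n - 1" and sim: "simulated d k"
  shows "simulated d (Suc k)"
proof -
  let ?s = "Suc k" and ?t = "B (n - d) (Suc k)"
  let ?F = "pd_front n D d ?s" and ?F' = "pd_front n D d (Suc ?s)"
  have F: "front n (n - 1) B d k = (\<lambda>a. erase R (?F (Suc a)))" and rec: "records_are R d ?F"
    using sim by (auto simp: simulated_def)
  have t: "?t \<in> {BlankT, HT, CrossT, JT, RT}"
    using B d k by (simp add: bvpd_def)
  have left: "LeftE \<in> edges ?t \<longleftrightarrow> erase R (?F ?s) \<noteq> 0"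
    and bot: "BottomE \<in> edges ?t \<longleftrightarrow> erase R (?F (Suc ?s)) \<noteq> 0"
    using front_edges[OF tiling_bvpd d, of k] k F by auto
  have inD: "(n - d, Suc ?s) \<in> D \<longleftrightarrow> RightE \<in> edges ?t"
    using cross_iff_right_edge[of "n - d" ?s] d k by simp
  have sd: "?s < d" if "RightE \<in> edges ?t"
    using D_triangle inD that d by (auto simp: triangle_def)
  have F': "?F' = (if RightE \<in> edges ?t \<and> ?F ?s < ?F (Suc ?s)
      then ?F(?s := ?F (Suc ?s), Suc ?s := ?F ?s) else ?F)"
    using pd_front_cell[OF d, of D ?s] inD sd by (auto simp: Let_def)
  have pos: "?F a \<noteq> 0" if "a \<le> d" for a
    using pd_front_pos[OF d that, of D ?s] d by auto
  have recs: "?F a \<in> R \<longleftrightarrow> (\<forall>b<a. ?F b < ?F a)" if "a \<le> d" for a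
    using rec that by (simp add: records_are_def)
  have swap_iff: "?F ?s < ?F (Suc ?s) \<longleftrightarrow> ?t = HT \<or> ?t = CrossT \<and> ?F ?s < ?F (Suc ?s)"
    if r: "RightE \<in> edges ?t"
  proof (cases ?t)
    case HT
    then have "?F (Suc ?s) \<in> R"
      using bot pos[of "Suc ?s"] sd[OF r] by (auto simp: erase_def split: if_splits)
    then show ?thesis using HT recs[of "Suc ?s"] sd[OF r] by simp
  next
    case RT
    have h: "?F ?s \<in> R" and q: "?F (Suc ?s) \<notin> R"
      using left bot RT pos[of ?s] sd[OF r] by (auto simp: erase_def split: if_splits)
    have "\<not> ?F ?s < ?F (Suc ?s)"
    proof
      assume "?F ?s < ?F (Suc ?s)"
      then have "\<forall>b<Suc ?s. ?F b < ?F (Suc ?s)"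
        using h recs[of ?s] sd[OF r] by (metis less_Suc_eq less_imp_le less_trans)
      then show False using q recs[of "Suc ?s"] sd[OF r] by simp
    qed
    then show ?thesis using RT by simp
  qed (use t r in auto)
  have "records_are R d ?F'"
  proof (cases "RightE \<in> edges ?t \<and> ?F ?s < ?F (Suc ?s)")
    case True
    then have "LeftE \<in> edges ?t"
      using swap_iff by auto
    then have "?F ?s \<notin> R"
      using left by (simp add: erase_def split: if_splits)
    then show ?thesis
      using records_are_swap[OF rec, of ?s] True F' sd by simp
  next
    case False
    then show ?thesis using rec F' by auto
  qed
  moreover have "cell_op ?t k (\<lambda>a. erase R (?F (Suc a))) = (\<lambda>a. erase R (?F' (Suc a)))"
  proof (cases "?t = CrossT \<or> ?t = HT")
    case True
    then show ?thesis
      using left bot F' swap_iff t by (auto simp: cell_op_def erase_def split: if_splits)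
  next
    case False
    then have "?F' = ?F"
      using F' swap_iff by auto
    then show ?thesis using False by (simp add: cell_op_def)
  qed
  ultimately show ?thesis
    using F by (simp add: simulated_def front.simps(3))
qed

lemma simulated: "d < n \<Longrightarrow> k \<le> n - 1 \<Longrightarrow> simulated d k"
proof (induction d arbitrary: k)
  case 0
  show ?case
    using 0(2) by (induction k) (use simulated_first simulated_cell 0 in auto)
next
  case (Suc d)
  have "simulated (Suc d) 0"
    using Suc simulated_row by simp
  then show ?case
    using Suc.prems(2) by (induction k) (use simulated_cell Suc.prems in auto)
qed

text \<open>
  The final front of the pipe dream and \<open>v\<close> agree after erasure, and in both the erased entries
  increase.
\<close>

lemma realizes_wty_bvpd: "realizes n D v"
proof -
  let ?F = "pd_front n D (n - 1) n"
  have sim: "front n (n - 1) B (n - 1) (n - 1) = (\<lambda>a. erase R (?F (Suc a)))"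
      "records_are R (n - 1) ?F"
    using simulated[of "n - 1" "n - 1"] n by (auto simp: simulated_def)
  have F: "bij_betw ?F {..<n} {1..n}"
    using final_front_bij[OF n] .
  have erase: "erase R (?F a) = erase R (v a)" if "a < n" for a
  proof (cases a)
    case 0
    have "?F 0 \<in> R" using sim(2) by (simp add: records_are_def)
    then show ?thesis using 0 first_mem_records by (simp add: erase_def)
  next
    case (Suc b)
    then have "b < n - 1" using that by simp
    then show ?thesis
      using fun_cong[OF sim(1), of b] final_front_bvpd[of b] Suc by simp
  qed
  have "?F a < ?F b" if "a < b" "b < n" "?F b \<in> R" for a b
    using sim(2) that by (simp add: records_are_def)
  moreover have "v a < v b" if "a < b" "b < n" "v b \<in> R" for a b
    using record_increasing[of v n b a] v that by (simp add: R_def bij_betw_def)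
  ultimately have "?F a = v a" if "a < n" for a
    using determined_by_nonrecords[OF F v _ erase] that by simp
  then show ?thesis
    using D_triangle by (simp add: realizes_def)
qed

text \<open>
  A nonrecord entering from below is visible in \<open>B\<close>, and every tile there with a bottom edge also has a
  right edge, which marks a cross of the pipe dream.
\<close>

lemma bad_bumps_wty_bvpd: "bad_bumps n v D = {}"
proof -
  have "pd_front n D (n - i) (j - 1) j \<in> R"
    if ij: "(i, j) \<in> triangle n" "(i, j) \<notin> D" for i j
  proof -
    have i: "1 \<le> i" "i \<le> n" "1 \<le> j" "j \<le> n - i" "j \<le> n - 1" "n - i < n"
      using ij by (auto simp: triangle_def)
    show ?thesis
    proof (cases "j = 1")
      case True
      then obtain d where d: "n - i = Suc d" "Suc d < n"
        using i by (cases "n - i") auto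
      have "records_are R d (pd_front n D d n)"
        using simulated[of d "n - 1"] d n by (simp add: simulated_def)
      then show ?thesis
        using True d by (simp add: pd_front_row records_are_def)
    next
      case False
      then obtain k where k: "j = Suc (Suc k)"
        using i by (metis One_nat_def Suc_le_D not0_implies_Suc)
      let ?t = "B i (Suc k)"
      have "RightE \<notin> edges ?t"
        using cross_iff_right_edge[of i "Suc k"] ij i k by simp
      moreover have "?t \<in> {BlankT, HT, CrossT, JT, RT}"
        using B i k by (simp add: bvpd_def)
      ultimately have "BottomE \<notin> edges ?t"
        by auto
      then have "front n (n - 1) B (n - i) k (Suc k) = 0"
        using front_edges[OF tiling_bvpd, of "n - i" k] i k by auto
      then have "erase R (pd_front n D (n - i) (Suc k) j) = 0"
        using simulated[of "n - i" k] i k by (simp add: simulated_def)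
      then show ?thesis
        using pd_front_pos[of "n - i" n j D "Suc k"] i k by (auto simp: erase_def split: if_splits)
    qed
  qed
  then show ?thesis
    by (auto simp: bad_bumps_def R_def)
qed

end

section \<open>Comparison of the two sums\<close>

text \<open>
  For a fireworks sequence the heads of the decreasing runs are the records: an entry after a descent is
  no record, and an entry after an ascent is one.
\<close>

lemma alpha_code_erases_records:
  fixes w :: "nat \<Rightarrow> nat"
  defines "v \<equiv> \<lambda>a. inv w (Suc a)"
  assumes n: "n \<ge> 1" and v: "inj_on v {..<n}" and fw: "inverse_fireworks n w"
  shows "alpha_code n w = map (\<lambda>c. erase (records n v) (v c)) [1..<n]"
    and "successively (\<lambda>x y. x < y \<longrightarrow> y \<in> records n v) (map v [0..<n])"
proof -
  define xs where "xs = map v [0..<n]"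
  have xs: "one_line n (inv w) = xs"
    by (rule nth_equalityI) (auto simp: one_line_def xs_def v_def simp del: upt_Suc)
  have len: "length xs = n" and nth: "\<And>j. j < n \<Longrightarrow> xs ! j = v j"
    by (simp_all add: xs_def)
  have sorted: "sorted_wrt (<) (map hd (dec_runs xs))"
    using fw xs by (simp add: inverse_fireworks_def fireworks_def)
  have rec: "v (Suc j) \<in> records n v" if "Suc j < n" "v j < v (Suc j)" for j
    using ascent_top_is_record[OF sorted, of j] that len nth unfolding records_def
    by (auto intro!: exI[of _ "Suc j"] simp: less_Suc_eq_le)
  then show "successively (\<lambda>x y. x < y \<longrightarrow> y \<in> records n v) (map v [0..<n])"
    by (simp add: successively_conv_nth)
  let ?c = "concat (map (\<lambda>r. 0 # tl r) (dec_runs xs))"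
  have "xs \<noteq> []" using len n by auto
  then have c: "length ?c = n" "\<And>j. j < n \<Longrightarrow> ?c ! j = (if 0 < j \<and> v j < v (j - 1) then v j else 0)"
    using erase_heads[of xs] len nth by auto
  have "tl ?c ! j = erase (records n v) (v (Suc j))" if "Suc j < n" for j
  proof -
    have "v j \<noteq> v (Suc j)"
      using inj_on_eq_iff[OF v, of j "Suc j"] that by simp
    moreover have "v (Suc j) < v j \<Longrightarrow> v (Suc j) \<notin> records n v"
      using record_increasing[OF v that, of j] by auto
    ultimately show ?thesis
      using c that rec[OF that] by (cases "v j < v (Suc j)") (auto simp: nth_tl erase_def)
  qed
  then show "alpha_code n w = map (\<lambda>c. erase (records n v) (v c)) [1..<n]"
    unfolding alpha_code_def xs by (intro nth_equalityI) (auto simp: c(1))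
qed

lemma PD_iff_realizes:
  assumes "n \<ge> 1"
  shows "P \<in> PD n w \<longleftrightarrow> (\<exists>D. realizes n D (\<lambda>a. inv w (Suc a)) \<and> P = pd_of n D)"
proof -
  have exit: "exit_pipe n n (pd_of n D) c = pd_front n D (n - 1) n (c - 1)" if "c \<in> {1..n}" for D c
    using exit_pipe_front[of n n "pd_of n D" c] pipe_dream_pd_of[of n D] that assms
    by (simp add: pipe_dream_def)
  have iff: "(\<forall>c\<in>{1..n}. exit_pipe n n (pd_of n D) c = inv w c) \<longleftrightarrow>
      (\<forall>a<n. pd_front n D (n - 1) n a = inv w (Suc a))" for D
  proof
    assume L: "\<forall>c\<in>{1..n}. exit_pipe n n (pd_of n D) c = inv w c"
    show "\<forall>a<n. pd_front n D (n - 1) n a = inv w (Suc a)"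
    proof (intro allI impI)
      fix a assume "a < n"
      then show "pd_front n D (n - 1) n a = inv w (Suc a)"
        using L exit[of "Suc a" D] by simp
    qed
  next
    assume R: "\<forall>a<n. pd_front n D (n - 1) n a = inv w (Suc a)"
    show "\<forall>c\<in>{1..n}. exit_pipe n n (pd_of n D) c = inv w c"
    proof
      fix c assume "c \<in> {1..n}"
      then show "exit_pipe n n (pd_of n D) c = inv w c"
        using R[rule_format, of "c - 1"] exit[of c D] by (cases c) auto
    qed
  qed
  show ?thesis
  proof
    assume P: "P \<in> PD n w"
    then have pd: "pd_of n (wty_PD n P) = P"
      by (simp add: PD_def pd_of_wty)
    have "wty_PD n (pd_of n E) \<subseteq> triangle n" for E
      by (auto simp: wty_PD_def cells_with_def pd_of_def triangle_def split: if_splits)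
    from this[of "wty_PD n P"] have "wty_PD n P \<subseteq> triangle n"
      using pd by simp
    then show "\<exists>D. realizes n D (\<lambda>a. inv w (Suc a)) \<and> P = pd_of n D"
      using P iff[of "wty_PD n P"] pd unfolding PD_def realizes_def
      by (intro exI[of _ "wty_PD n P"]) simp
  next
    assume "\<exists>D. realizes n D (\<lambda>a. inv w (Suc a)) \<and> P = pd_of n D"
    then show "P \<in> PD n w"
      using iff pipe_dream_pd_of by (auto simp: PD_def realizes_def)
  qed
qed

theorem theorem4p3:
  fixes n :: nat and w :: "nat \<Rightarrow> nat"
  assumes "n \<ge> 1"
    and "w permutes {1..n}"
    and "inverse_fireworks n w"
  shows "CM_poly n w = (\<Sum>B\<in>BVPD n w. weight (wty_BVPD n B))"
proof -
  define v where "v = (\<lambda>a. inv w (Suc a))"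
  have "bij_betw (inv w) {1..n} {1..n}"
    using permutes_inv[OF assms(2)] by (rule permutes_imp_bij)
  moreover have "bij_betw Suc {..<n} {1..n}"
    by (rule bij_betw_byWitness[where f' = "\<lambda>c. c - 1"]) auto
  ultimately have v: "bij_betw v {..<n} {1..n}"
    using bij_betw_trans[of Suc _ _ "inv w"] by (simp add: v_def comp_def)
  then have inj: "inj_on v {..<n}"
    by (simp add: bij_betw_def)
  note fireworks = alpha_code_erases_records[OF assms(1) inj[unfolded v_def] assms(3), folded v_def]

  let ?M = "{P \<in> PD n w. \<forall>Q\<in>PD n w. card (wty_PD n Q) \<le> card (wty_PD n P)}"
  let ?\<D> = "{D. realizes n D v \<and> bad_bumps n v D = {}}"
  have PD: "P \<in> PD n w \<longleftrightarrow> (\<exists>D. realizes n D v \<and> P = pd_of n D)" for P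
    using PD_iff_realizes[OF assms(1), of P w] by (simp add: v_def)
  have wty: "wty_PD n (pd_of n D) = D" if "realizes n D v" for D
    using that wty_pd_of by (simp add: realizes_def)
  have fin: "finite (bad_bumps n v D)" for D
    by (rule finite_subset[OF _ finite_triangle[of n]]) (auto simp: bad_bumps_def)
  let ?G = "greedy_crosses n v"
  have G: "realizes n ?G v" "bad_bumps n v ?G = {}"
    using realizes_greedy_crosses[OF v assms(1)] no_bad_bumps_greedy_crosses[OF v fireworks(2)] .
  have le: "card D \<le> card E \<longleftrightarrow> card (bad_bumps n v E) \<le> card (bad_bumps n v D)"
    if "realizes n D v" "realizes n E v" for D E
    using card_crosses[OF that(1) assms(1)] card_crosses[OF that(2) assms(1)] by linarith
\<comment> \<open>Existence of one pipe dream without bad bumps makes the maximum equivalent to their absence.\<close>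
    have max_iff: "pd_of n D \<in> ?M \<longleftrightarrow> bad_bumps n v D = {}" if D: "realizes n D v" for D
  proof
    assume M: "pd_of n D \<in> ?M"
    have "pd_of n ?G \<in> PD n w" using PD G(1) by blast
    then have "card (wty_PD n (pd_of n ?G)) \<le> card (wty_PD n (pd_of n D))"
      using M by blast
    then have "card ?G \<le> card D" using wty[OF G(1)] wty[OF D] by simp
    then have "card (bad_bumps n v D) = 0"
      using le[OF G(1) D] G(2) by simp
    then show "bad_bumps n v D = {}" using fin[of D] by simp
  next
    assume good: "bad_bumps n v D = {}"
    have "card (wty_PD n Q) \<le> card (wty_PD n (pd_of n D))" if Q: "Q \<in> PD n w" for Q
    proof -
      obtain E where E: "realizes n E v" "Q = pd_of n E"
        using PD[of Q] Q by blast
      then show ?thesis using le[OF E(1) D] good wty[OF E(1)] wty[OF D] by simp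
    qed
    then show "pd_of n D \<in> ?M" using PD[of "pd_of n D"] D by blast
  qed
  have image_PD: "wty_PD n ` ?M = ?\<D>"
  proof (intro equalityI subsetI)
    fix D assume "D \<in> wty_PD n ` ?M"
    then obtain P where P: "P \<in> ?M" "D = wty_PD n P" by blast
    obtain E where E: "realizes n E v" "P = pd_of n E"
      using PD[of P] P(1) by blast
    have "D = E" using P(2) E(2) wty[OF E(1)] by simp
    moreover have "bad_bumps n v E = {}" using max_iff[OF E(1)] P(1) E(2) by blast
    ultimately show "D \<in> ?\<D>" using E(1) by blast
  next
    fix D assume "D \<in> ?\<D>"
    then have D: "realizes n D v" "pd_of n D \<in> ?M" using max_iff[of D] by blast+
    then show "D \<in> wty_PD n ` ?M"
      using wty[OF D(1)] by (intro image_eqI[of _ _ "pd_of n D"]) simp_all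
  qed
  have inj_PD: "inj_on (wty_PD n) ?M"
  proof (rule inj_onI)
    fix P Q assume "P \<in> ?M" "Q \<in> ?M" and eq: "wty_PD n P = wty_PD n Q"
    then have "pipe_dream n P" "pipe_dream n Q" by (simp_all add: PD_def)
    then show "P = Q"
      using pd_of_wty[of n P] pd_of_wty[of n Q] eq by metis
  qed
  have CM: "CM_poly n w = (\<Sum>D\<in>?\<D>. weight D)"
    unfolding CM_poly_def image_PD[symmetric] sum.reindex[OF inj_PD] comp_def ..

  have BVPD: "B \<in> BVPD n w \<longleftrightarrow>
      bvpd n B \<and> (\<forall>c\<in>{1..<n}. exit_pipe n (n - 1) B c = erase (records n v) (v c))" for B
    unfolding BVPD_def column_to_row_code_def fireworks(1) by (simp add: v_def)
  have image_BVPD: "wty_BVPD n ` BVPD n w = ?\<D>"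
  proof (intro equalityI subsetI)
    fix D assume "D \<in> wty_BVPD n ` BVPD n w"
    then obtain B where B: "B \<in> BVPD n w" "D = wty_BVPD n B" by blast
    then have "bvpd n B" "\<And>c. c \<in> {1..<n} \<Longrightarrow> exit_pipe n (n - 1) B c = erase (records n v) (v c)"
      using BVPD[of B] by blast+
    then show "D \<in> ?\<D>"
      using realizes_wty_bvpd[OF assms(1) v, of B] bad_bumps_wty_bvpd[OF assms(1) v, of B] B(2) by blast
  next
    fix D assume D: "D \<in> ?\<D>"
    let ?B = "shadow n (records n v) D"
    have good: "realizes n D v" "bad_bumps n v D = {}" using D by blast+
    have "?B \<in> BVPD n w"
      using BVPD[of ?B] bvpd_shadow[OF assms(1) good] exit_pipe_shadow[OF assms(1) good] by blast
    then show "D \<in> wty_BVPD n ` BVPD n w"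
      using wty_shadow[OF assms(1) good] by (intro image_eqI[of _ _ ?B]) simp_all
  qed
  have inj_BVPD: "inj_on (wty_BVPD n) (BVPD n w)"
    using BVPD bvpd_eqI by (intro inj_onI) blast
  have "(\<Sum>B\<in>BVPD n w. weight (wty_BVPD n B)) = (\<Sum>D\<in>?\<D>. weight D)"
    unfolding image_BVPD[symmetric] sum.reindex[OF inj_BVPD] comp_def ..
  then show ?thesis using CM by simp
qed

end
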